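(* Let $W:\mathbb{R}\to\mathbb{R}$ be a double-well potential such that: (1) $W$ is continuous; (2) $W\ge0$ and $W(z)=0$ if and only if $z=\pm1$; (3) $\liminf_{z\to\pm\infty}W(z)>0$. For $s\in(\frac12,1)$ let $$m_s=\inf\left\{\int_{\mathbb{R}}W(u)\,dt+\iint_{\mathbb{R}\times\mathbb{R}}\frac{|u(x)-u(y)|^2}{|x-y|^{1+2s}}\,dx\,dy\ :\ u\in H^s_{\mathrm{loc}}(\mathbb{R}),\ u(\pm\infty)=\pm1\right\}.$$ Then the function on $[\frac12,1)$ defined by $$s\longmapsto\begin{cases} m_{\frac12}=8 & \text{if } s=\frac12,\\ (2s-1)\,m_s & \text{if } s\in(\frac12,1),\end{cases}$$ (the surface tension of the $\Gamma$-limit as $\varepsilon\to0$ of the scaled functionals at exponent $s$) is continuous on $[\frac12,1)$.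
   Context: For $s>\frac12$ functions in $H^s_{\mathrm{loc}}(\mathbb{R})$ are identified with their continuous representatives; $u(\pm\infty)=\pm1$ means $\lim_{x\to+\infty}u(x)=1$ and $\lim_{x\to-\infty}u(x)=-1$. The scaled functionals referred to are $\mathcal{F}^s_\varepsilon(u)=\lambda(\varepsilon,s)\big(\frac1\varepsilon\int_{(0,1)}W(u)\,dt+\varepsilon^{2s-1}\iint_{(0,1)^2}\frac{|u(x)-u(y)|^2}{|x-y|^{1+2s}}\,dx\,dy\big)$ with $\lambda(\varepsilon,\frac12)=\frac1{|\log\varepsilon|}$ and $\lambda(\varepsilon,s)=\frac{1-2s}{\varepsilon^{2s-1}-1}$ for $s\in(\frac12,1)$; their $\Gamma$-limit as $\varepsilon\to0$ is the displayed constant times the number of jump points of $u$ for $u\in BV((0,1),\{-1,1\})$, and $+\infty$ otherwise. *)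

theory Defs
  imports "HOL-Analysis.Analysis"
begin

definition double_well :: "(real \<Rightarrow> real) \<Rightarrow> bool" where
  "double_well W \<longleftrightarrow>
     continuous_on UNIV W \<and>
     (\<forall>z. 0 \<le> W z) \<and>
     (\<forall>z. W z = 0 \<longleftrightarrow> z = 1 \<or> z = - 1) \<and>
     Liminf at_top (\<lambda>z. ereal (W z)) > 0 \<and>
     Liminf at_bot (\<lambda>z. ereal (W z)) > 0"

(* On the diagonal the integrand is 0 / 0 = 0 in HOL; the diagonal is a Lebesgue null set. *)
definition gagliardo :: "real \<Rightarrow> real set \<Rightarrow> (real \<Rightarrow> real) \<Rightarrow> ennreal" where
  "gagliardo s A u =
     (\<integral>\<^sup>+ z \<in> A \<times> A.
        ennreal (\<bar>u (fst z) - u (snd z)\<bar>\<^sup>2 / \<bar>fst z - snd z\<bar> powr (1 + 2 * s))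
      \<partial>(lborel \<Otimes>\<^sub>M lborel))"

definition Hs_loc :: "real \<Rightarrow> (real \<Rightarrow> real) set" where
  "Hs_loc s =
     {u \<in> borel_measurable lborel.
        \<forall>a b. (\<integral>\<^sup>+ x \<in> {a<..<b}. ennreal (\<bar>u x\<bar>\<^sup>2) \<partial>lborel) < \<infinity> \<and>
              gagliardo s {a<..<b} u < \<infinity>}"

(* For s > 1/2 every class in H^s_loc has exactly one continuous representative;
   requiring continuity selects it. *)
definition transitions :: "real \<Rightarrow> (real \<Rightarrow> real) set" where
  "transitions s =
     {u \<in> Hs_loc s. continuous_on UNIV u \<and> (u \<longlongrightarrow> 1) at_top \<and> (u \<longlongrightarrow> - 1) at_bot}"

definition energy :: "(real \<Rightarrow> real) \<Rightarrow> real \<Rightarrow> (real \<Rightarrow> real) \<Rightarrow> ennreal" where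
  "energy W s u = (\<integral>\<^sup>+ t. ennreal (W (u t)) \<partial>lborel) + gagliardo s UNIV u"

definition min_energy :: "(real \<Rightarrow> real) \<Rightarrow> real \<Rightarrow> ennreal" where
  "min_energy W s = (INF u \<in> transitions s. energy W s u)"

(* enn2real sends infinity to 0, so this is the intended value only where min_energy is finite. *)
definition surface_tension :: "(real \<Rightarrow> real) \<Rightarrow> real \<Rightarrow> real" where
  "surface_tension W s =
     (if s = 1 / 2 then 8 else (2 * s - 1) * enn2real (min_energy W s))"

end

theory Submission
  imports Defs "HOL-Probability.Helly_Selection" "HOL-Real_Asymp.Real_Asymp"
begin

text \<open>
  Writing \<open>D u r\<close> for the integral of \<open>(u (x + r) - u x)\<^sup>2\<close> over \<open>x\<close>, the seminorm is twice the
  integral of \<open>D u r * r powr - (1 + 2 * s)\<close> over \<open>r > 0\<close>, so every comparison of seminorms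
  reduces to a comparison of \<open>D\<close>.

  Upper semicontinuity in \<open>s\<close>: \<open>m\<^sub>s\<close> is an infimum of functions continuous in \<open>s\<close>, because the
  competitors may be taken Lipschitz and equal to \<open>\<plusminus>1\<close> outside a compact set.  To reach the value \<open>1\<close>
  one takes the maximum with a far away ramp, which costs almost nothing since the seminorm is
  submodular; averaging over short windows then makes the competitor Lipschitz.  For a fixed
  such competitor the energy is a finite convex function of \<open>s\<close>, hence continuous.

  Lower semicontinuity: increasing rearrangement does not increase \<open>D u r\<close>, so almost optimal
  competitors may be taken monotone.  Helly selection and Fatou's lemma give a monotone limit;
  it has no jumps because its seminorm is finite, and its limits are \<open>\<plusminus>1\<close> because its potential
  energy is finite.

  As \<open>s\<close> decreases to \<open>1/2\<close>, a fixed profile gives the upper bound \<open>8 / (2 * s - 1) + O(1)\<close>.  Conversely,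
  if \<open>\<bar>u\<bar> \<le> 1 - \<eta>\<close> on a set of measure at most \<open>L\<close>, then \<open>D u r \<ge> 4 * (1 - \<eta>)\<^sup>2 * (r - L)\<close>, and the energy
  bound \<open>8 / (2 * s - 1)\<close> allows \<open>L\<close> of order \<open>1 / (2 * s - 1)\<close>, whose power \<open>L powr (1 - 2 * s)\<close> tends to \<open>1\<close>.
\<close>

section \<open>The seminorm as an integral over increments\<close>

definition sqdiff :: "(real \<Rightarrow> real) \<Rightarrow> real \<Rightarrow> ennreal" where
  "sqdiff u r = (\<integral>\<^sup>+x. ennreal ((u (x + r) - u x)\<^sup>2) \<partial>lborel)"

lemma nn_integral_lborel_shift:
  fixes f :: "real \<Rightarrow> ennreal"
  assumes "f \<in> borel_measurable borel"
  shows "(\<integral>\<^sup>+x. f (x + a) \<partial>lborel) = (\<integral>\<^sup>+x. f x \<partial>lborel)"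
  using nn_integral_real_affine[of f 1 a] assms by (simp add: add.commute)

lemma nn_integral_lborel_reflect:
  fixes f :: "real \<Rightarrow> ennreal"
  assumes "f \<in> borel_measurable borel"
  shows "(\<integral>\<^sup>+x. f (- x) \<partial>lborel) = (\<integral>\<^sup>+x. f x \<partial>lborel)"
  using nn_integral_real_affine[of f "-1" 0] assms by simp

lemma sqdiff_minus:
  assumes [measurable]: "u \<in> borel_measurable borel"
  shows "sqdiff u (- r) = sqdiff u r"
proof -
  have "(\<integral>\<^sup>+x. ennreal ((u (x - r) - u x)\<^sup>2) \<partial>lborel)
      = (\<integral>\<^sup>+x. ennreal ((u ((x + r) - r) - u (x + r))\<^sup>2) \<partial>lborel)"
    by (rule nn_integral_lborel_shift[symmetric]) measurable
  then show ?thesis by (simp add: sqdiff_def power2_commute)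
qed

lemma measurable_sqdiff [measurable]:
  assumes [measurable]: "u \<in> borel_measurable borel"
  shows "sqdiff u \<in> borel_measurable borel"
proof -
  have "(\<lambda>r. \<integral>\<^sup>+x. ennreal ((u (x + r) - u x)\<^sup>2) \<partial>lborel) \<in> borel_measurable borel"
    by measurable
  then show ?thesis by (simp add: sqdiff_def[abs_def])
qed

text \<open>The substitution x = y + r and Tonelli turn the double integral into one over
  increments. The factor 2 comes from folding r < 0 onto r > 0, since \<open>sqdiff u\<close> and
  the kernel are both even.\<close>

lemma gagliardo_eq:
  assumes [measurable]: "u \<in> borel_measurable borel"
  shows "gagliardo s UNIV u =
    2 * (\<integral>\<^sup>+r\<in>{0<..}. sqdiff u r * ennreal (r powr - (1 + 2 * s)) \<partial>lborel)"
proof -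
  define k where "k r = ennreal (\<bar>r\<bar> powr - (1 + 2 * s))" for r :: real
  have [measurable]: "k \<in> borel_measurable borel" by (simp add: k_def[abs_def])
  have *: "ennreal (\<bar>a\<bar>\<^sup>2 / \<bar>r\<bar> powr (1 + 2 * s)) = ennreal (a\<^sup>2) * k r" for a r
    by (simp only: k_def powr_minus divide_inverse power2_abs) (simp add: ennreal_mult)
  have "gagliardo s UNIV u = (\<integral>\<^sup>+z. (\<lambda>z. ennreal ((u (fst z) - u (snd z))\<^sup>2) * k (fst z - snd z)) z \<partial>(lborel \<Otimes>\<^sub>M lborel))"
    unfolding gagliardo_def by (simp only: * ) simp
  also have "\<dots> = (\<integral>\<^sup>+y. \<integral>\<^sup>+x. ennreal ((u x - u y)\<^sup>2) * k (x - y) \<partial>lborel \<partial>lborel)"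
    by (subst lborel_pair.nn_integral_snd[symmetric]) simp_all
  also have "\<dots> = (\<integral>\<^sup>+y. \<integral>\<^sup>+r. ennreal ((u (r + y) - u y)\<^sup>2) * k r \<partial>lborel \<partial>lborel)"
  proof (rule nn_integral_cong)
    fix y :: real
    have "(\<integral>\<^sup>+r. (\<lambda>x. ennreal ((u x - u y)\<^sup>2) * k (x - y)) (r + y) \<partial>lborel)
      = (\<integral>\<^sup>+x. (\<lambda>x. ennreal ((u x - u y)\<^sup>2) * k (x - y)) x \<partial>lborel)"
      by (rule nn_integral_lborel_shift) measurable
    then show "(\<integral>\<^sup>+x. ennreal ((u x - u y)\<^sup>2) * k (x - y) \<partial>lborel)
      = (\<integral>\<^sup>+r. ennreal ((u (r + y) - u y)\<^sup>2) * k r \<partial>lborel)" by simp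
  qed
  also have "\<dots> = (\<integral>\<^sup>+r. \<integral>\<^sup>+y. ennreal ((u (r + y) - u y)\<^sup>2) * k r \<partial>lborel \<partial>lborel)"
    by (rule lborel_pair.Fubini') measurable
  also have "\<dots> = (\<integral>\<^sup>+r. sqdiff u r * k r \<partial>lborel)"
    by (simp add: nn_integral_multc sqdiff_def add.commute)
  also have "\<dots> = (\<integral>\<^sup>+r. sqdiff u r * k r * indicator {0<..} r + sqdiff u r * k r * indicator {..<0} r \<partial>lborel)"
    by (rule nn_integral_cong_AE, rule AE_I'[of "{0}"]) (auto simp: indicator_def)
  also have "\<dots> = (\<integral>\<^sup>+r. sqdiff u r * k r * indicator {0<..} r \<partial>lborel) + (\<integral>\<^sup>+r. sqdiff u r * k r * indicator {..<0} r \<partial>lborel)"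
    by (rule nn_integral_add) measurable
  also have "(\<integral>\<^sup>+r. sqdiff u r * k r * indicator {..<0} r \<partial>lborel)
      = (\<integral>\<^sup>+r. sqdiff u (-r) * k (-r) * indicator {..<0} (-r) \<partial>lborel)"
    by (rule nn_integral_lborel_reflect[symmetric]) measurable
  also have "\<dots> = (\<integral>\<^sup>+r. sqdiff u r * k r * indicator {0<..} r \<partial>lborel)"
    by (intro nn_integral_cong) (auto simp: sqdiff_minus k_def indicator_def)
  also have "(\<integral>\<^sup>+r. sqdiff u r * k r * indicator {0<..} r \<partial>lborel)
     = (\<integral>\<^sup>+r\<in>{0<..}. sqdiff u r * ennreal (r powr - (1 + 2 * s)) \<partial>lborel)"
    by (intro nn_integral_cong) (auto simp: k_def indicator_def)
  finally show ?thesis by (simp only: mult_2)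
qed

lemma gagliardo_mono_sqdiff:
  assumes "u \<in> borel_measurable borel" "v \<in> borel_measurable borel"
    and "\<And>r. 0 < r \<Longrightarrow> sqdiff u r \<le> sqdiff v r"
  shows "gagliardo s UNIV u \<le> gagliardo s UNIV v"
  unfolding gagliardo_eq[OF assms(1)] gagliardo_eq[OF assms(2)]
  using assms(3) by (intro mult_left_mono nn_integral_mono) (auto simp: indicator_def intro!: mult_right_mono)

lemma gagliardo_contraction:
  assumes "\<And>x y. \<bar>u x - u y\<bar> \<le> \<bar>v x - v y\<bar>"
  shows "gagliardo s A u \<le> gagliardo s A v"
  unfolding gagliardo_def using assms
  by (intro nn_integral_mono mult_right_mono ennreal_leI divide_right_mono power_mono) auto

lemma gagliardo_subset: "gagliardo s A u \<le> gagliardo s UNIV u"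
  unfolding gagliardo_def by (intro nn_integral_mono) (auto simp: indicator_def)

text \<open>A finite global seminorm bounds every local one, and continuity on compact intervals
  gives local square integrability.\<close>

lemma transitionsI:
  assumes c: "continuous_on UNIV u" and "(u \<longlongrightarrow> 1) at_top" "(u \<longlongrightarrow> - 1) at_bot"
    and G: "gagliardo s UNIV u < \<infinity>"
  shows "u \<in> transitions s"
proof -
  have m[measurable]: "u \<in> borel_measurable borel" using c by (rule borel_measurable_continuous_onI)
  have "(\<integral>\<^sup>+ x \<in> {a<..<b}. ennreal (\<bar>u x\<bar>\<^sup>2) \<partial>lborel) < \<infinity>" for a b
  proof -
    have "compact (u ` {a..b})"
      using c by (intro compact_continuous_image) (auto intro: continuous_on_subset)
    then obtain B where B: "\<And>x. x \<in> {a..b} \<Longrightarrow> \<bar>u x\<bar> \<le> B"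
      using compact_imp_bounded bounded_iff by (metis (no_types, lifting) image_eqI real_norm_def)
    have "(\<integral>\<^sup>+ x \<in> {a<..<b}. ennreal (\<bar>u x\<bar>\<^sup>2) \<partial>lborel) \<le> (\<integral>\<^sup>+ x \<in> {a<..<b}. ennreal (B\<^sup>2) \<partial>lborel)"
      using B by (intro nn_integral_mono) (auto simp: indicator_def intro!: ennreal_leI, metis abs_ge_zero atLeastAtMost_iff less_imp_le power2_abs power_mono)
    also have "\<dots> < \<infinity>" by (cases "a \<le> b") (simp_all add: nn_integral_cmult_indicator ennreal_mult_less_top)
    finally show ?thesis .
  qed
  moreover have "gagliardo s {a<..<b} u < \<infinity>" for a b
    using gagliardo_subset G by (rule le_less_trans)
  ultimately show ?thesis using assms by (simp add: transitions_def Hs_loc_def)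
qed

lemma transitionsD:
  assumes "u \<in> transitions s"
  shows "continuous_on UNIV u" "u \<in> borel_measurable borel" "(u \<longlongrightarrow> 1) at_top" "(u \<longlongrightarrow> - 1) at_bot"
  using assms by (auto simp: transitions_def Hs_loc_def)


section \<open>Profiles that are constant outside a compact set\<close>

definition plateau :: "real \<Rightarrow> (real \<Rightarrow> real) \<Rightarrow> bool" where
  "plateau T u \<longleftrightarrow> (\<forall>x. \<bar>u x\<bar> \<le> 1) \<and> (\<forall>x\<ge>T. u x = 1) \<and> (\<forall>x\<le>-T. u x = -1)"

lemma plateauD:
  assumes "plateau T u"
  shows "\<bar>u x\<bar> \<le> 1" "T \<le> x \<Longrightarrow> u x = 1" "x \<le> - T \<Longrightarrow> u x = -1" "0 < T"
proof -
  show "\<bar>u x\<bar> \<le> 1" "T \<le> x \<Longrightarrow> u x = 1" "x \<le> - T \<Longrightarrow> u x = -1"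
    using assms by (auto simp: plateau_def)
  show "0 < T"
  proof (rule ccontr)
    assume "\<not> 0 < T"
    then have "u 0 = 1" "u 0 = -1" using assms by (auto simp: plateau_def)
    then show False by simp
  qed
qed

lemma plateau_limits:
  assumes "plateau T u"
  shows "(u \<longlongrightarrow> 1) at_top" "(u \<longlongrightarrow> -1) at_bot"
  using plateauD(2,3)[OF assms]
  by (auto intro!: tendsto_eventually eventually_at_top_linorderI[of T] eventually_at_bot_linorderI[of "- T"])

text \<open>Both x and x + r lie in the same constant half-line unless x belongs to [-T - r, T], an
  interval of length r + 2T.\<close>

lemma sqdiff_plateau_le:
  assumes u: "plateau T u" and r: "0 < r" and c: "\<And>x. \<bar>u (x + r) - u x\<bar> \<le> c"
  shows "sqdiff u r \<le> ennreal (c\<^sup>2 * (r + 2 * T))"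
proof -
  have "sqdiff u r \<le> (\<integral>\<^sup>+x. ennreal (c\<^sup>2) * indicator {- T - r..T} x \<partial>lborel)"
    unfolding sqdiff_def
  proof (rule nn_integral_mono)
    fix x
    show "ennreal ((u (x + r) - u x)\<^sup>2) \<le> ennreal (c\<^sup>2) * indicator {- T - r..T} x"
    proof (cases "x \<in> {- T - r..T}")
      case True
      have "(u (x + r) - u x)\<^sup>2 \<le> c\<^sup>2" using c[of x] by (rule abs_le_square_iff[THEN iffD1, OF order_trans]) simp
      then show ?thesis using True by (simp add: ennreal_leI)
    next
      case False
      then have "u (x + r) = u x"
        using plateauD[OF u] r by (cases "x > T") auto
      then show ?thesis by simp
    qed
  qed
  also have "\<dots> = ennreal (c\<^sup>2 * (r + 2 * T))"
    using r plateauD(4)[OF u] by (simp add: nn_integral_cmult_indicator ennreal_mult algebra_simps)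
  finally show ?thesis .
qed

lemma nn_integral_powr_atLeast:
  assumes "e < -1" "0 < a"
  shows "(\<integral>\<^sup>+x\<in>{a..}. ennreal (x powr e) \<partial>lborel) = ennreal (a powr (e + 1) / - (e + 1))"
  using nn_integral_has_integral_lebesgue'[OF _ has_integral_powr_to_inf[OF assms]]
  by (simp only: powr_ge_zero minus_divide_left[symmetric] minus_divide_right)

lemma nn_integral_powr_Icc_0:
  assumes "-1 < e" "0 \<le> c"
  shows "(\<integral>\<^sup>+x\<in>{0..c}. ennreal (x powr e) \<partial>lborel) = ennreal (c powr (e + 1) / (e + 1))"
  using nn_integral_has_integral_lebesgue'[OF _ has_integral_powr_from_0[OF assms]] by simp

text \<open>The integral over r is split at 1. For r < 1 increments are at most L r, so
  \<open>sqdiff u r\<close> is at most (1 + 2T) L^2 r^2. For r \<ge> 1 they are at most 2, so it is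
  at most 4r + 8T. The part 4r alone produces 8 / (2s - 1), the only term that blows up as s
  decreases to 1/2; its coefficient 8 becomes the limit value.\<close>

lemma gagliardo_lipschitz_plateau:
  assumes u: "plateau T u" and m: "u \<in> borel_measurable borel"
    and L: "\<And>x y. \<bar>u x - u y\<bar> \<le> L * \<bar>x - y\<bar>" and s: "1/2 < s" "s < 1"
  shows "gagliardo s UNIV u \<le> ennreal (2 * ((1 + 2 * T) * L\<^sup>2) / (2 - 2 * s) + 8 / (2 * s - 1) + 8 * T / s)"
proof -
  have T: "0 < T" using plateauD(4)[OF u] .
  have "(\<integral>\<^sup>+r\<in>{0<..}. sqdiff u r * ennreal (r powr - (1 + 2 * s)) \<partial>lborel)
    \<le> (\<integral>\<^sup>+r. (ennreal ((1 + 2 * T) * L\<^sup>2) * (ennreal (r powr (1 - 2 * s)) * indicator {0..1} r)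
        + ennreal 4 * (ennreal (r powr (- 2 * s)) * indicator {1..} r))
        + ennreal (8 * T) * (ennreal (r powr - (1 + 2 * s)) * indicator {1..} r) \<partial>lborel)"
  proof (rule nn_integral_mono)
    fix r :: real
    consider "r \<le> 0" | "0 < r" "r < 1" | "1 \<le> r" by linarith
    then show "sqdiff u r * ennreal (r powr - (1 + 2 * s)) * indicator {0<..} r \<le>
      (ennreal ((1 + 2 * T) * L\<^sup>2) * (ennreal (r powr (1 - 2 * s)) * indicator {0..1} r)
        + ennreal 4 * (ennreal (r powr (- 2 * s)) * indicator {1..} r))
        + ennreal (8 * T) * (ennreal (r powr - (1 + 2 * s)) * indicator {1..} r)"
    proof cases
      case 2
      have "sqdiff u r \<le> ennreal ((L * r)\<^sup>2 * (r + 2 * T))"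
        using 2 L by (intro sqdiff_plateau_le[OF u]) (auto, metis abs_of_pos add_diff_cancel_left')
      also have "\<dots> \<le> ennreal ((1 + 2 * T) * L\<^sup>2 * r\<^sup>2)"
        using 2 mult_left_mono[of "r + 2 * T" "1 + 2 * T" "(L * r)\<^sup>2"]
        by (intro ennreal_leI) (simp add: power_mult_distrib algebra_simps)
      finally have "sqdiff u r * ennreal (r powr - (1 + 2 * s))
          \<le> ennreal ((1 + 2 * T) * L\<^sup>2 * r\<^sup>2) * ennreal (r powr - (1 + 2 * s))"
        by (rule mult_right_mono) simp
      also have "\<dots> = ennreal ((1 + 2 * T) * L\<^sup>2 * (r\<^sup>2 * r powr - (1 + 2 * s)))"
        using T by (simp add: ennreal_mult[symmetric] mult.assoc)
      also have "r\<^sup>2 * r powr - (1 + 2 * s) = r powr (1 - 2 * s)"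
        using 2 by (simp add: powr_add[symmetric] flip: powr_numeral)
      finally show ?thesis using 2 T by (simp add: ennreal_mult)
    next
      case 3
      have "\<bar>u (x + r) - u x\<bar> \<le> 2" for x
        using plateauD(1)[OF u, of x] plateauD(1)[OF u, of "x + r"] by linarith
      then have "sqdiff u r \<le> ennreal (2\<^sup>2 * (r + 2 * T))"
        using 3 by (intro sqdiff_plateau_le[OF u]) auto
      then have "sqdiff u r * ennreal (r powr - (1 + 2 * s))
          \<le> ennreal (2\<^sup>2 * (r + 2 * T)) * ennreal (r powr - (1 + 2 * s))"
        by (rule mult_right_mono) simp
      also have "\<dots> = ennreal (4 * (r * r powr - (1 + 2 * s)) + 8 * T * r powr - (1 + 2 * s))"
        using T 3 by (simp add: ennreal_mult[symmetric] algebra_simps)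
      also have "r * r powr - (1 + 2 * s) = r powr (- 2 * s)"
        using 3 powr_mult_base[of r "- (1 + 2 * s)"] by simp
      also have "ennreal (4 * r powr (- 2 * s) + 8 * T * r powr - (1 + 2 * s))
          = ennreal 4 * ennreal (r powr (- 2 * s)) + ennreal (8 * T) * ennreal (r powr - (1 + 2 * s))"
        using T by (subst (1 2) ennreal_mult[symmetric]) (auto simp: ennreal_plus)
      also have "\<dots> \<le> (ennreal ((1 + 2 * T) * L\<^sup>2) * (ennreal (r powr (1 - 2 * s)) * indicator {0..1} r)
          + ennreal 4 * ennreal (r powr (- 2 * s))) + ennreal (8 * T) * ennreal (r powr - (1 + 2 * s))"
        by (intro add_right_mono add_increasing) simp_all
      finally have "sqdiff u r * ennreal (r powr - (1 + 2 * s)) \<le> \<dots>" .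
      moreover have "indicator {0<..} r = (1::ennreal)" "indicator {1..} r = (1::ennreal)"
        using 3 by auto
      ultimately show ?thesis by (simp only: mult_1_right)
    qed simp
  qed
  also have "\<dots> = ennreal ((1 + 2 * T) * L\<^sup>2) * ennreal (1 / (2 - 2 * s)) + ennreal 4 * ennreal (1 / (2 * s - 1))
      + ennreal (8 * T) * ennreal (1 / (2 * s))"
    using s by (simp add: nn_integral_add nn_integral_cmult nn_integral_powr_atLeast nn_integral_powr_Icc_0)
  also have "\<dots> = ennreal ((1 + 2 * T) * L\<^sup>2 / (2 - 2 * s) + 4 / (2 * s - 1) + 4 * T / s)"
    using s T by (simp add: ennreal_mult[symmetric] ennreal_plus[symmetric] del: ennreal_plus ennreal_numeral)
  finally have "gagliardo s UNIV u \<le> ennreal 2 * ennreal ((1 + 2 * T) * L\<^sup>2 / (2 - 2 * s) + 4 / (2 * s - 1) + 4 * T / s)"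
    unfolding gagliardo_eq[OF m] by (simp add: mult_left_mono)
  also have "\<dots> = ennreal (2 * ((1 + 2 * T) * L\<^sup>2) / (2 - 2 * s) + 8 / (2 * s - 1) + 8 * T / s)"
    using s T by (subst ennreal_mult[symmetric]) (auto simp: algebra_simps)
  finally show ?thesis .
qed

text \<open>At fixed distance r > 0 the kernel is \<open>exp (- (1 + 2 * s) * ln r)\<close>, the
  exponential of an affine function of s. On the diagonal \<open>0 powr a = 0\<close> makes both
  sides vanish.\<close>

lemma gagliardo_convex:
  assumes [measurable]: "u \<in> borel_measurable borel" and t: "0 < t" "t < 1"
  shows "gagliardo ((1 - t) * a + t * b) UNIV u \<le> ennreal (1 - t) * gagliardo a UNIV u + ennreal t * gagliardo b UNIV u"
proof -
  let ?g = "\<lambda>s z. ennreal (\<bar>u (fst z) - u (snd z)\<bar>\<^sup>2 / \<bar>fst z - snd z\<bar> powr (1 + 2 * s))"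
  have "?g ((1 - t) * a + t * b) z \<le> ennreal (1 - t) * ?g a z + ennreal t * ?g b z" for z
  proof -
    define r where "r = \<bar>fst z - snd z\<bar>"
    have "r powr - (1 + 2 * ((1 - t) * a + t * b)) \<le> (1 - t) * r powr - (1 + 2 * a) + t * r powr - (1 + 2 * b)"
    proof (cases "r = 0")
      case False
      have "exp ((1 - t) *\<^sub>R (- (1 + 2 * a) * ln r) + t *\<^sub>R (- (1 + 2 * b) * ln r))
        \<le> (1 - t) * exp (- (1 + 2 * a) * ln r) + t * exp (- (1 + 2 * b) * ln r)"
        using t by (intro convex_onD[OF exp_convex]) auto
      moreover have "(1 - t) *\<^sub>R (- (1 + 2 * a) * ln r) + t *\<^sub>R (- (1 + 2 * b) * ln r)
        = - (1 + 2 * ((1 - t) * a + t * b)) * ln r" by (simp add: algebra_simps)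
      ultimately show ?thesis using False by (simp add: powr_def)
    qed simp
    then have "\<bar>u (fst z) - u (snd z)\<bar>\<^sup>2 * r powr - (1 + 2 * ((1 - t) * a + t * b))
      \<le> \<bar>u (fst z) - u (snd z)\<bar>\<^sup>2 * ((1 - t) * r powr - (1 + 2 * a) + t * r powr - (1 + 2 * b))"
      by (rule mult_left_mono) simp
    then have "\<bar>u (fst z) - u (snd z)\<bar>\<^sup>2 / r powr (1 + 2 * ((1 - t) * a + t * b))
      \<le> (1 - t) * (\<bar>u (fst z) - u (snd z)\<bar>\<^sup>2 / r powr (1 + 2 * a)) + t * (\<bar>u (fst z) - u (snd z)\<bar>\<^sup>2 / r powr (1 + 2 * b))"
      by (simp only: powr_minus divide_inverse) (simp add: algebra_simps)
    then show ?thesis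
      using t unfolding r_def
      by (simp only: ennreal_mult[symmetric] ennreal_plus[symmetric] ennreal_leI
        divide_nonneg_nonneg zero_le_power abs_ge_zero powr_ge_zero mult_nonneg_nonneg less_imp_le diff_ge_0_iff_ge)
  qed
  then have "gagliardo ((1 - t) * a + t * b) UNIV u
    \<le> (\<integral>\<^sup>+z. ennreal (1 - t) * ?g a z + ennreal t * ?g b z \<partial>(lborel \<Otimes>\<^sub>M lborel))"
    unfolding gagliardo_def by (intro nn_integral_mono) simp
  also have "\<dots> = ennreal (1 - t) * gagliardo a UNIV u + ennreal t * gagliardo b UNIV u"
    by (simp add: gagliardo_def nn_integral_add nn_integral_cmult)
  finally show ?thesis .
qed

text \<open>A finite convex function on an open interval is continuous. Finiteness also lets
  \<open>enn2real\<close> carry the convexity inequality over to the reals.\<close>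

lemma continuous_on_gagliardo:
  assumes m: "u \<in> borel_measurable borel" and fin: "\<And>s. s \<in> {a<..<b} \<Longrightarrow> gagliardo s UNIV u < \<infinity>"
  shows "continuous_on {a<..<b} (\<lambda>s. enn2real (gagliardo s UNIV u))"
proof (rule convex_on_continuous, simp, rule convex_onI)
  fix t x y :: real
  assume *: "0 < t" "t < 1" "x \<in> {a<..<b}" "y \<in> {a<..<b}"
  have "enn2real (gagliardo ((1 - t) * x + t * y) UNIV u)
    \<le> enn2real (ennreal (1 - t) * gagliardo x UNIV u + ennreal t * gagliardo y UNIV u)"
    using fin[OF *(3)] fin[OF *(4)] *
    by (intro enn2real_mono gagliardo_convex m) (auto simp: ennreal_mult_less_top)
  also have "\<dots> = (1 - t) * enn2real (gagliardo x UNIV u) + t * enn2real (gagliardo y UNIV u)"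
    using fin[OF *(3)] fin[OF *(4)] * by (simp add: enn2real_plus ennreal_mult_less_top enn2real_mult)
  finally show "enn2real (gagliardo ((1 - t) *\<^sub>R x + t *\<^sub>R y) UNIV u)
    \<le> (1 - t) * enn2real (gagliardo x UNIV u) + t * enn2real (gagliardo y UNIV u)" by simp
qed simp


section \<open>Increasing rearrangement\<close>

lemma emeasure_lborel_shift:
  fixes A :: "real set"
  assumes [measurable]: "A \<in> sets borel"
  shows "emeasure lborel {x. x + a \<in> A} = emeasure lborel A"
proof -
  have "emeasure lborel {x. x + a \<in> A} = (\<integral>\<^sup>+x. indicator {x. x + a \<in> A} x \<partial>lborel)"
    by (rule nn_integral_indicator[symmetric]) measurable
  also have "\<dots> = (\<integral>\<^sup>+x. indicator A (x + a) \<partial>lborel)"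
    by (simp add: indicator_def)
  also have "\<dots> = (\<integral>\<^sup>+x. indicator A x \<partial>lborel)"
    by (rule nn_integral_lborel_shift) measurable
  finally show ?thesis by simp
qed

lemma crossing_measure:
  fixes u :: "real \<Rightarrow> real"
  assumes [measurable]: "u \<in> borel_measurable borel" and r: "0 < r" and tt: "t \<le> t'" and T: "0 \<le> T"
    and up: "\<And>x. T \<le> x \<Longrightarrow> t' \<le> u x" and low: "\<And>x. x \<le> - T \<Longrightarrow> u x < t"
  shows "ennreal r \<le> emeasure lborel {x. u x < t \<and> t' \<le> u (x + r)} + emeasure lborel {x. t \<le> u x \<and> u x < t'}"
    (is "_ \<le> emeasure _ ?M + emeasure _ ?C")
proof -
  \<comment> \<open>Translating the superlevel set \<open>{t' \<le> u}\<close> to the left by \<open>r\<close> increases its measure in a large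
    window by exactly \<open>r\<close>.\<close>
  define A where "A = {x. x \<in> {-T..T} \<and> t' \<le> u x}"
  define B where "B = {x. x \<in> {-T..T+r} \<and> t' \<le> u x}"
  have [measurable]: "A \<in> sets borel" "B \<in> sets borel" by (simp_all add: A_def B_def)
  have "emeasure lborel A \<le> emeasure lborel {-T..T}"
    by (rule emeasure_mono) (auto simp: A_def)
  also have "\<dots> < \<infinity>" using T by simp
  finally have fin: "emeasure lborel A < \<infinity>" .
  have "B = A \<union> {T<..T+r}"
    using up r T by (auto simp: A_def B_def)
  moreover have "emeasure lborel (A \<union> {T<..T+r}) = emeasure lborel A + emeasure lborel {T<..T+r}"
    by (rule plus_emeasure[symmetric]) (auto simp: A_def)
  ultimately have "ennreal r + emeasure lborel A = emeasure lborel B"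
    using r by (simp add: add.commute)
  also have "\<dots> = emeasure lborel {x. x + r \<in> B}"
    by (rule emeasure_lborel_shift[symmetric]) measurable
  also have "\<dots> \<le> emeasure lborel (?M \<union> ?C \<union> A)"
  proof (rule emeasure_mono)
    \<comment> \<open>A point outside the first two sets satisfies \<open>t' \<le> u x\<close>. It
      then lies in A: \<open>low\<close> places it to the right of -T, and
      \<open>x + r \<le> T + r\<close> keeps it at most T.\<close>
    show "{x. x + r \<in> B} \<subseteq> ?M \<union> ?C \<union> A"
      using low tt by (force simp: A_def B_def)
  qed measurable
  also have "\<dots> \<le> emeasure lborel ?M + emeasure lborel ?C + emeasure lborel A"
    by (intro order_trans[OF emeasure_subadditive] add_right_mono emeasure_subadditive) measurable
  finally show ?thesis
    using fin by (auto simp: add.commute[of _ "emeasure lborel A"] ennreal_add_left_cancel_le)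
qed

text \<open>Upward increments are the ones that \<open>crossing_measure\<close> bounds from below.
  For a monotone function nothing is lost by ignoring the others, so comparing \<open>rise\<close>
  is enough to compare \<open>sqdiff\<close> with a monotone rearrangement.\<close>

definition rise :: "(real \<Rightarrow> real) \<Rightarrow> real \<Rightarrow> ennreal" where
  "rise u r = (\<integral>\<^sup>+x. ennreal ((max 0 (u (x + r) - u x))\<^sup>2) \<partial>lborel)"

lemma rise_le_sqdiff: "rise u r \<le> sqdiff u r"
  unfolding rise_def sqdiff_def by (intro nn_integral_mono ennreal_leI) (auto simp: max_def)

lemma rise_eq_sqdiff:
  assumes "mono u" "0 < r"
  shows "rise u r = sqdiff u r"
  unfolding rise_def sqdiff_def using monoD[OF assms(1)] assms(2)
  by (intro nn_integral_cong) (auto simp: max_def)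

text \<open>For a < b the pairs (t, h) fill a right triangle with both legs b - a, of area (b - a)^2
  / 2; for b \<le> a there are none.\<close>

lemma square_layer_cake:
  fixes a b :: real
  shows "ennreal ((max 0 (b - a))\<^sup>2) = 2 * (\<integral>\<^sup>+t. \<integral>\<^sup>+h. (if 0 < h \<and> a < t \<and> t + h \<le> b then 1 else 0) \<partial>lborel \<partial>lborel)"
proof -
  have inner: "(\<integral>\<^sup>+h. (if 0 < h \<and> a < t \<and> t + h \<le> b then 1 else 0) \<partial>lborel)
      = ennreal (b - t) * indicator {a<..b} t" for t
  proof -
    have "(\<integral>\<^sup>+h. (if 0 < h \<and> a < t \<and> t + h \<le> b then 1 else 0) \<partial>lborel)
      = (\<integral>\<^sup>+h. indicator {a<..b} t * indicator {0<..b - t} h \<partial>lborel)"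
      by (intro nn_integral_cong) (auto simp: indicator_def)
    also have "\<dots> = ennreal (b - t) * indicator {a<..b} t"
      by (cases "t \<le> b") (simp_all add: nn_integral_cmult mult.commute)
    finally show ?thesis .
  qed
  have "(\<integral>\<^sup>+t. ennreal (b - t) * indicator {a<..b} t \<partial>lborel) = ennreal ((max 0 (b - a))\<^sup>2 / 2)"
  proof (cases "a \<le> b")
    case True
    have "(\<integral>\<^sup>+t. ennreal (b - t) * indicator {a<..b} t \<partial>lborel) = (\<integral>\<^sup>+t. ennreal (b - t) * indicator {a..b} t \<partial>lborel)"
      by (rule nn_integral_cong_AE, rule AE_I'[of "{a}"]) (auto simp: indicator_def)
    also have "\<dots> = ennreal ((\<lambda>t. - (b - t)\<^sup>2 / 2) b - (\<lambda>t. - (b - t)\<^sup>2 / 2) a)"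
      using True by (intro nn_integral_FTC_Icc) (auto intro!: derivative_eq_intros simp: field_simps)
    finally show ?thesis using True by simp
  qed simp
  then show ?thesis
    unfolding inner by (simp add: ennreal_mult'[symmetric] del: ennreal_numeral flip: ennreal_numeral)
qed

text \<open>Integrating the triangle formula over x and exchanging the integrals reduces any
  comparison of \<open>rise\<close> to a comparison of crossing sets, one pair of levels t and t + h
  at a time.\<close>

lemma rise_layer_cake:
  assumes [measurable]: "u \<in> borel_measurable borel"
  shows "rise u r = 2 * (\<integral>\<^sup>+t. (\<integral>\<^sup>+h\<in>{0<..}. emeasure lborel {x. u x < t \<and> t + h \<le> u (x + r)} \<partial>lborel) \<partial>lborel)"
proof -
  let ?f = "\<lambda>x t h. (if 0 < h \<and> u x < t \<and> t + h \<le> u (x + r) then 1 else 0) :: ennreal"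
  have inner: "(\<integral>\<^sup>+x. ?f x t h \<partial>lborel) = emeasure lborel {x. u x < t \<and> t + h \<le> u (x + r)} * indicator {0<..} h" for t h
  proof -
    have "(\<integral>\<^sup>+x. ?f x t h \<partial>lborel) = (\<integral>\<^sup>+x. indicator {x. u x < t \<and> t + h \<le> u (x + r)} x * indicator {0<..} h \<partial>lborel)"
      by (intro nn_integral_cong) (auto simp: indicator_def)
    also have "\<dots> = emeasure lborel {x. u x < t \<and> t + h \<le> u (x + r)} * indicator {0<..} h"
      by (subst nn_integral_multc) simp_all
    finally show ?thesis .
  qed
  have "rise u r = (\<integral>\<^sup>+x. 2 * (\<integral>\<^sup>+t. \<integral>\<^sup>+h. ?f x t h \<partial>lborel \<partial>lborel) \<partial>lborel)"
    unfolding rise_def square_layer_cake ..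
  also have "\<dots> = 2 * (\<integral>\<^sup>+x. \<integral>\<^sup>+t. \<integral>\<^sup>+h. ?f x t h \<partial>lborel \<partial>lborel \<partial>lborel)"
    by (rule nn_integral_cmult) measurable
  also have "(\<integral>\<^sup>+x. \<integral>\<^sup>+t. \<integral>\<^sup>+h. ?f x t h \<partial>lborel \<partial>lborel \<partial>lborel) = (\<integral>\<^sup>+t. \<integral>\<^sup>+x. \<integral>\<^sup>+h. ?f x t h \<partial>lborel \<partial>lborel \<partial>lborel)"
    by (rule lborel_pair.Fubini') measurable
  also have "\<dots> = (\<integral>\<^sup>+t. \<integral>\<^sup>+h. \<integral>\<^sup>+x. ?f x t h \<partial>lborel \<partial>lborel \<partial>lborel)"
    by (intro nn_integral_cong lborel_pair.Fubini') measurable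
  finally show ?thesis unfolding inner .
qed

text \<open>For \<open>-1 < t \<le> 1\<close>, the rearranged function is below \<open>t\<close> exactly on the half-line to the left of
  \<open>shifted_distr T u t\<close>.  The disjunct \<open>t = -1\<close> keeps the supremum away from the empty set.\<close>

definition shifted_distr :: "real \<Rightarrow> (real \<Rightarrow> real) \<Rightarrow> real \<Rightarrow> real" where
  "shifted_distr T u t = measure lborel {x. x \<in> {-T..T} \<and> u x < t} - T"

definition incr_rearr :: "real \<Rightarrow> (real \<Rightarrow> real) \<Rightarrow> real \<Rightarrow> real" where
  "incr_rearr T u x = Sup {t. t \<in> {-1..1} \<and> (t = -1 \<or> shifted_distr T u t \<le> x)}"

context
  fixes T :: real and u :: "real \<Rightarrow> real"
  assumes u: "plateau T u" and m[measurable]: "u \<in> borel_measurable borel"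
begin

lemma sublevel_fmeasurable: "{x. x \<in> {-T..T} \<and> u x < t} \<in> fmeasurable lborel"
  by (rule fmeasurableI2[of "{-T..T}"]) (auto intro!: fmeasurable_compact)

lemma shifted_distr_mono: "t \<le> t' \<Longrightarrow> shifted_distr T u t \<le> shifted_distr T u t'"
  unfolding shifted_distr_def using sublevel_fmeasurable by (intro diff_right_mono measure_mono_fmeasurable) (auto simp: fmeasurableD)

lemma shifted_distr_bounds: "- T \<le> shifted_distr T u t" "shifted_distr T u t \<le> T"
proof -
  have "measure lborel {x. x \<in> {-T..T} \<and> u x < t} \<le> measure lborel {-T..T}"
    using sublevel_fmeasurable by (intro measure_mono_fmeasurable) (auto simp: fmeasurableD intro!: fmeasurable_compact)
  then show "shifted_distr T u t \<le> T" using plateauD(4)[OF u] by (simp add: shifted_distr_def)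
qed (simp add: shifted_distr_def)

text \<open>This is left continuity of the distribution function: strict sublevel sets increase to
  \<open>{u < t}\<close> as the level increases to t, and the measure is continuous along increasing
  unions.\<close>

lemma shifted_distr_left:
  assumes "\<And>t'. t' < t \<Longrightarrow> -1 < t' \<Longrightarrow> shifted_distr T u t' \<le> x" "-1 < t"
  shows "shifted_distr T u t \<le> x"
proof -
  \<comment> \<open>At n = 0 the level is the midpoint of (-1, t), and the levels increase to t from
    there, so the hypothesis applies to each of them.\<close>
  define S where "S n = {y. y \<in> {-T..T} \<and> u y < t - (t + 1) / (real n + 2)}" for n :: nat
  have "(\<lambda>n. measure lborel (S n)) \<longlonglongrightarrow> measure lborel (\<Union>n. S n)"
  proof (rule Lim_measure_incseq)
    show "range S \<subseteq> sets lborel" by (auto simp: S_def)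
    show "incseq S" unfolding incseq_def S_def
    proof (intro allI impI subsetI CollectI conjI; elim CollectE conjE)
      fix i j :: nat and y assume "i \<le> j" and y: "u y < t - (t + 1) / (real i + 2)"
      then have "(t + 1) / (real j + 2) \<le> (t + 1) / (real i + 2)" using assms(2) by (intro divide_left_mono) auto
      then show "u y < t - (t + 1) / (real j + 2)" using y by linarith
    qed
    have "emeasure lborel (\<Union>n. S n) \<le> emeasure lborel {-T..T}" by (rule emeasure_mono) (auto simp: S_def)
    then show "emeasure lborel (\<Union>n. S n) \<noteq> \<infinity>" using plateauD(4)[OF u] by (auto simp: top_unique)
  qed
  moreover have "(\<Union>n. S n) = {y. y \<in> {-T..T} \<and> u y < t}"
  proof (intro equalityI subsetI)
    fix y assume y: "y \<in> {y. y \<in> {-T..T} \<and> u y < t}"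
    have "(\<lambda>n::nat. t - (t + 1) / (real n + 2)) \<longlonglongrightarrow> t" by real_asymp
    then have "\<forall>\<^sub>F n in sequentially. u y < t - (t + 1) / (real n + 2)"
      using y by (intro order_tendstoD) auto
    then show "y \<in> (\<Union>n. S n)" using y by (auto simp: S_def eventually_sequentially)
  next
    fix y assume "y \<in> (\<Union>n. S n)"
    then obtain n where n: "y \<in> {-T..T}" "u y < t - (t + 1) / (real n + 2)" by (auto simp: S_def)
    moreover have "0 \<le> (t + 1) / (real n + 2)" using assms(2) by simp
    ultimately show "y \<in> {y. y \<in> {-T..T} \<and> u y < t}" by auto
  qed
  ultimately have "(\<lambda>n. measure lborel (S n) - T) \<longlonglongrightarrow> shifted_distr T u t"
    unfolding shifted_distr_def by (intro tendsto_intros) simp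
  moreover have "measure lborel (S n) - T \<le> x" for n
  proof -
    define d where "d = (t + 1) / (real n + 2)"
    have "0 < d" "d \<le> (t + 1) / 2"
      using assms(2) divide_left_mono[of 2 "real n + 2" "t + 1"] by (simp_all add: d_def)
    then have "shifted_distr T u (t - d) \<le> x"
      using assms(2) by (intro assms(1)) (simp_all add: field_simps)
    then show ?thesis by (simp add: shifted_distr_def S_def d_def)
  qed
  ultimately show ?thesis
    by (intro LIMSEQ_le_const2[where X = "\<lambda>n. measure lborel (S n) - T"]) auto
qed

lemma incr_rearr_bounds: "\<bar>incr_rearr T u x\<bar> \<le> 1"
proof -
  have "-1 \<le> incr_rearr T u x"
    unfolding incr_rearr_def by (rule cSup_upper) (auto intro!: bdd_aboveI[of _ 1])
  moreover have "incr_rearr T u x \<le> 1"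
    unfolding incr_rearr_def by (rule cSup_least) (auto intro!: exI[of _ "-1"])
  ultimately show ?thesis by simp
qed

text \<open>Superlevel sets of the rearrangement become closed half-lines, which is how it enters
  every later computation. The direction from left to right says that the supremum is attained,
  which is where left continuity of the distribution function is used.\<close>

lemma incr_rearr_ge_iff:
  assumes "-1 < t" "t \<le> 1"
  shows "t \<le> incr_rearr T u x \<longleftrightarrow> shifted_distr T u t \<le> x"
proof
  assume "shifted_distr T u t \<le> x"
  then show "t \<le> incr_rearr T u x"
    using assms unfolding incr_rearr_def by (intro cSup_upper) (auto intro!: bdd_aboveI[of _ 1])
next
  assume t: "t \<le> incr_rearr T u x"
  show "shifted_distr T u t \<le> x"
  proof (rule shifted_distr_left[OF _ assms(1)])
    fix t' assume t': "t' < t" "-1 < t'"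
    then have "t' < incr_rearr T u x" using t by simp
    then obtain \<tau> where "\<tau> \<in> {-1..1}" "\<tau> = -1 \<or> shifted_distr T u \<tau> \<le> x" "t' < \<tau>"
      unfolding incr_rearr_def by (subst (asm) less_cSup_iff) (auto intro!: bdd_aboveI[of _ 1] exI[of _ "-1"])
    then show "shifted_distr T u t' \<le> x" using t' shifted_distr_mono[of t' \<tau>] by auto
  qed
qed

lemma mono_incr_rearr: "mono (incr_rearr T u)"
proof (rule monoI)
  fix x y :: real assume "x \<le> y"
  then show "incr_rearr T u x \<le> incr_rearr T u y"
    unfolding incr_rearr_def by (intro cSup_subset_mono) (auto intro!: bdd_aboveI[of _ 1] exI[of _ "-1"])
qed

text \<open>The left half-line is open because a jump of u at -T may raise the right-continuous
  rearrangement at -T itself.\<close>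

lemma incr_rearr_outside:
  "T \<le> x \<Longrightarrow> incr_rearr T u x = 1" "x < - T \<Longrightarrow> incr_rearr T u x = -1"
proof -
  assume "T \<le> x"
  then show "incr_rearr T u x = 1"
    using incr_rearr_ge_iff[of 1 x] shifted_distr_bounds(2)[of 1] incr_rearr_bounds[of x] by simp
next
  assume x: "x < - T"
  show "incr_rearr T u x = -1"
  proof (rule ccontr)
    assume "incr_rearr T u x \<noteq> -1"
    then have "-1 < incr_rearr T u x" "incr_rearr T u x \<le> 1" using incr_rearr_bounds[of x] by auto
    from incr_rearr_ge_iff[OF this, of x] show False using x shifted_distr_bounds(1)[of "incr_rearr T u x"] by simp
  qed
qed

text \<open>Sublevel sets \<open>{v < a}\<close> of the rearrangement v are open half-lines, so v is
  upper semicontinuous; monotonicity gives the other bound from the right. Helly selection relies on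
  this property.\<close>

lemma continuous_at_right_incr_rearr: "continuous (at_right x) (incr_rearr T u)"
  unfolding continuous_within
proof (rule order_tendstoI)
  fix a assume "a < incr_rearr T u x"
  then show "\<forall>\<^sub>F y in at_right x. a < incr_rearr T u y"
    using monoD[OF mono_incr_rearr] unfolding eventually_at_filter
    by (intro always_eventually) (auto intro: less_le_trans)
next
  fix a assume a: "incr_rearr T u x < a"
  show "\<forall>\<^sub>F y in at_right x. incr_rearr T u y < a"
  proof (cases "a \<le> 1")
    case True
    have "-1 < a" using a incr_rearr_bounds[of x] by linarith
    then have *: "incr_rearr T u y < a \<longleftrightarrow> y < shifted_distr T u a" for y
      using incr_rearr_ge_iff[of a y] True by auto
    have "x < shifted_distr T u a" using a * by simp
    then show ?thesis unfolding * by (rule eventually_at_right_real[THEN eventually_mono]) auto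
  next
    case False
    then have "incr_rearr T u y < a" for y using incr_rearr_bounds[of y] by linarith
    then show ?thesis by simp
  qed
qed

lemma measurable_incr_rearr [measurable]: "incr_rearr T u \<in> borel_measurable borel"
  using mono_incr_rearr by (rule borel_measurable_mono)

lemma emeasure_between:
  assumes "-1 < t" "t \<le> t'" "t' \<le> 1"
  shows "emeasure lborel {x. t \<le> u x \<and> u x < t'} = ennreal (shifted_distr T u t' - shifted_distr T u t)"
proof -
  define A where "A s = {x. x \<in> {-T..T} \<and> u x < s}" for s
  have [measurable]: "A s \<in> sets borel" for s by (simp add: A_def)
  have A: "emeasure lborel (A s) = ennreal (shifted_distr T u s + T)" for s
    using emeasure_eq_measure2[OF sublevel_fmeasurable[of s]] by (simp add: A_def shifted_distr_def)
  \<comment> \<open>Outside the window u takes only the values 1 and -1, and both are excluded by -1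
    < t and t' \<le> 1.\<close>
  have "{x. t \<le> u x \<and> u x < t'} = A t' - A t"
  proof -
    have "x \<in> {-T..T}" if "t \<le> u x" "u x < t'" for x
      using that assms plateauD(2,3)[OF u, of x] by (cases "x < -T"; cases "x > T") auto
    then show ?thesis by (auto simp: A_def)
  qed
  then have "emeasure lborel {x. t \<le> u x \<and> u x < t'} = emeasure lborel (A t' - A t)"
    by (simp only:)
  also have "\<dots> = emeasure lborel (A t') - emeasure lborel (A t)"
  proof (rule emeasure_Diff)
    show "emeasure lborel (A t) \<noteq> \<infinity>" by (simp add: A)
    show "A t \<subseteq> A t'" using assms by (auto simp: A_def)
  qed simp_all
  also have "\<dots> = ennreal (shifted_distr T u t' - shifted_distr T u t)"
    unfolding A using shifted_distr_bounds(1)[of t] by (subst ennreal_minus) simp_all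
  finally show ?thesis .
qed

text \<open>By the layer-cake formula it suffices to compare crossing sets of levels t and t + h.
  For the rearrangement this set is an interval of length r - d, or empty when d \<ge> r, where d is
  the measure of the points with values in between. For u, \<open>crossing_measure\<close> gives at
  least r - d.\<close>

lemma rise_incr_rearr_le:
  assumes "0 < r"
  shows "rise (incr_rearr T u) r \<le> rise u r"
  unfolding rise_layer_cake[OF m] rise_layer_cake[OF measurable_incr_rearr]
proof (intro mult_left_mono nn_integral_mono)
  fix t h :: real
  let ?v = "incr_rearr T u"
  consider "h \<le> 0" | "0 < h" "t \<le> -1" | "0 < h" "1 < t + h" | "0 < h" "-1 < t" "t + h \<le> 1" by linarith
  then show "emeasure lborel {x. ?v x < t \<and> t + h \<le> ?v (x + r)} * indicator {0<..} h
      \<le> emeasure lborel {x. u x < t \<and> t + h \<le> u (x + r)} * indicator {0<..} h"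
  proof cases
    case 2
    then have "\<not> ?v x < t" for x using incr_rearr_bounds[of x] by linarith
    then have "{x. ?v x < t \<and> t + h \<le> ?v (x + r)} = {}" by blast
    then show ?thesis by (simp only: emeasure_empty mult_zero_left zero_le)
  next
    case 3
    then have "\<not> t + h \<le> ?v x" for x using incr_rearr_bounds[of x] by linarith
    then have "{x. ?v x < t \<and> t + h \<le> ?v (x + r)} = {}" by blast
    then show ?thesis by (simp only: emeasure_empty mult_zero_left zero_le)
  next
    case 4
    define d where "d = shifted_distr T u (t + h) - shifted_distr T u t"
    have d: "0 \<le> d" using shifted_distr_mono[of t "t + h"] 4 by (simp add: d_def)
    have eq: "{x. ?v x < t \<and> t + h \<le> ?v (x + r)} = {shifted_distr T u (t + h) - r..<shifted_distr T u t}"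
      using incr_rearr_ge_iff[of t] incr_rearr_ge_iff[of "t + h"] 4 by (auto simp: not_le[symmetric])
    have "emeasure lborel {x. ?v x < t \<and> t + h \<le> ?v (x + r)} = ennreal (r - d)"
      unfolding eq by (cases "d \<le> r") (auto simp: d_def ennreal_neg algebra_simps)
    moreover have "ennreal r \<le> emeasure lborel {x. u x < t \<and> t + h \<le> u (x + r)} + ennreal d"
      unfolding d_def using 4 assms plateauD[OF u]
      by (subst emeasure_between[symmetric]) (auto intro!: crossing_measure[OF m, of _ _ _ T])
    ultimately show ?thesis
      using d by (auto simp: indicator_def ennreal_minus[symmetric] ennreal_minus_le_iff add.commute)
  qed simp
qed simp

lemma sqdiff_incr_rearr_le:
  assumes "0 < r"
  shows "sqdiff (incr_rearr T u) r \<le> sqdiff u r"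
  using rise_incr_rearr_le[OF assms] rise_eq_sqdiff[OF mono_incr_rearr assms] rise_le_sqdiff[of u r] by simp

text \<open>The two functions are equidistributed on [-T, T]: the part of \<open>{v < t}\<close> in
  the window is an interval whose length is the measure of the corresponding part of
  \<open>{u < t}\<close>. Beyond the window both functions sit in the zeros of W.\<close>

lemma nn_integral_incr_rearr:
  assumes [measurable]: "W \<in> borel_measurable borel" and W: "W 1 = (0::ennreal)" "W (-1) = 0"
  shows "(\<integral>\<^sup>+x. W (incr_rearr T u x) \<partial>lborel) = (\<integral>\<^sup>+x. W (u x) \<partial>lborel)"
proof -
  let ?v = "incr_rearr T u"
  \<comment> \<open>The sign turns strict sublevel sets of w into rays \<open>{a<..}\<close>, on
    which finite measures are compared by \<open>measure_eqI_lessThan\<close>. The density restricts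
    to the window to keep the measures finite.\<close>
  define N where "N w = distr (density lborel (indicator {-T..T})) borel (\<lambda>x. - w x)" for w :: "real \<Rightarrow> real"
  have emN: "emeasure (N w) {a<..} = emeasure lborel {x. x \<in> {-T..T} \<and> w x < - a}"
    if [measurable]: "w \<in> borel_measurable borel" for w a
  proof -
    have "emeasure (N w) {a<..} = emeasure lborel ({-T..T} \<inter> {x. a < - w x})"
      unfolding N_def by (subst emeasure_distr) (simp_all add: emeasure_density vimage_def indicator_inter_arith[symmetric])
    then show ?thesis by (simp add: less_minus_iff Int_def conj_commute)
  qed
  have "N ?v = N u"
  proof (rule measure_eqI_lessThan)
    fix a :: real
    show "emeasure (N ?v) {a<..} < \<infinity>"
    proof -
      have "emeasure (N ?v) {a<..} \<le> emeasure lborel {-T..T}" by (subst emN) (auto intro!: emeasure_mono)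
      also have "\<dots> < \<infinity>" using plateauD(4)[OF u] by simp
      finally show ?thesis .
    qed
    have "emeasure lborel {x. x \<in> {-T..T} \<and> ?v x < t} = emeasure lborel {x. x \<in> {-T..T} \<and> u x < t}" for t
    proof -
      consider "t \<le> -1" | "1 < t" | "-1 < t" "t \<le> 1" by linarith
      then show ?thesis
      proof cases
        case 1
        then have "\<not> ?v x < t" "\<not> u x < t" for x using incr_rearr_bounds[of x] plateauD(1)[OF u, of x] by linarith+
        then show ?thesis by simp
      next
        case 2
        then have "?v x < t" "u x < t" for x using incr_rearr_bounds[of x] plateauD(1)[OF u, of x] by linarith+
        then show ?thesis by simp
      next
        case 3
        then have "?v x < t \<longleftrightarrow> x < shifted_distr T u t" for x
          using incr_rearr_ge_iff[of t x] by linarith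
        then have "{x. x \<in> {-T..T} \<and> ?v x < t} = {x. x \<in> {-T..T} \<and> x < shifted_distr T u t}"
          by (simp only:)
        also have "\<dots> = {-T..<shifted_distr T u t}"
          using shifted_distr_bounds[of t] by (intro set_eqI) (simp, linarith)
        finally have "emeasure lborel {x. x \<in> {-T..T} \<and> ?v x < t} = ennreal (shifted_distr T u t + T)"
          using shifted_distr_bounds(1)[of t] by (simp only:) simp
        then show ?thesis
          using emeasure_eq_measure2[OF sublevel_fmeasurable[of t]] by (simp add: shifted_distr_def)
      qed
    qed
    then show "emeasure (N ?v) {a<..} = emeasure (N u) {a<..}" by (simp add: emN)
  qed (simp_all add: N_def)
  have I: "(\<integral>\<^sup>+x. W (w x) \<partial>lborel) = (\<integral>\<^sup>+y. W (- y) \<partial>N w)"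
    if [measurable]: "w \<in> borel_measurable borel" and out: "\<And>x. T < x \<Longrightarrow> w x = 1" "\<And>x. x < - T \<Longrightarrow> w x = -1" for w
  proof -
    have "(\<integral>\<^sup>+y. W (- y) \<partial>N w) = (\<integral>\<^sup>+x. indicator {-T..T} x * W (w x) \<partial>lborel)"
      unfolding N_def by (subst nn_integral_distr) (auto simp: nn_integral_density)
    also have "\<dots> = (\<integral>\<^sup>+x. W (w x) \<partial>lborel)"
      using out W by (intro nn_integral_cong) (auto simp: indicator_def not_le)
    finally show ?thesis by simp
  qed
  have "(\<integral>\<^sup>+x. W (?v x) \<partial>lborel) = (\<integral>\<^sup>+y. W (- y) \<partial>N ?v)"
    by (rule I) (simp_all add: incr_rearr_outside)
  also have "\<dots> = (\<integral>\<^sup>+y. W (- y) \<partial>N u)" by (simp only: \<open>N ?v = N u\<close>)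
  also have "\<dots> = (\<integral>\<^sup>+x. W (u x) \<partial>lborel)"
    by (rule I[symmetric]) (simp_all add: plateauD(2,3)[OF u])
  finally show ?thesis .
qed

end


section \<open>Fatou property and submodularity of the seminorm\<close>

text \<open>Placing the factor 2, the kernel and the cutoff r > 0 under a single
  \<open>ennreal\<close> lets convergence of the integrand be checked for real numbers before
  Fatou's lemma is applied.\<close>

lemma gagliardo_eq_iterated:
  assumes [measurable]: "u \<in> borel_measurable borel"
  shows "gagliardo s UNIV u =
    (\<integral>\<^sup>+r. \<integral>\<^sup>+x. ennreal (2 * ((u (x + r) - u x)\<^sup>2 * (r powr - (1 + 2 * s) * indicator {0<..} r))) \<partial>lborel \<partial>lborel)"
proof -
  have "2 * (sqdiff u r * ennreal (r powr - (1 + 2 * s)) * indicator {0<..} r)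
    = (\<integral>\<^sup>+x. ennreal (2 * ((u (x + r) - u x)\<^sup>2 * (r powr - (1 + 2 * s) * indicator {0<..} r))) \<partial>lborel)" for r
  proof -
    have "(\<integral>\<^sup>+x. ennreal (2 * ((u (x + r) - u x)\<^sup>2 * (r powr - (1 + 2 * s) * indicator {0<..} r))) \<partial>lborel)
      = (\<integral>\<^sup>+x. 2 * (ennreal ((u (x + r) - u x)\<^sup>2) * ennreal (r powr - (1 + 2 * s) * indicator {0<..} r)) \<partial>lborel)"
      by (intro nn_integral_cong) (simp add: ennreal_mult)
    also have "\<dots> = 2 * (sqdiff u r * ennreal (r powr - (1 + 2 * s) * indicator {0<..} r))"
      by (simp add: nn_integral_cmult nn_integral_multc sqdiff_def)
    finally show ?thesis by (auto simp: indicator_def)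
  qed
  then show ?thesis
    unfolding gagliardo_eq[OF assms] by (subst nn_integral_cmult[symmetric]) simp_all
qed

text \<open>Fatou's lemma is applied first in x and then in r. For fixed r the integrand may fail to
  converge only on C and its translate by -r, a countable set; the varying exponent is harmless
  because the kernel is continuous in it.\<close>

lemma gagliardo_fatou:
  assumes m[measurable]: "\<And>n. u n \<in> borel_measurable borel" "v \<in> borel_measurable borel"
    and C: "countable C" "\<And>x. x \<notin> C \<Longrightarrow> (\<lambda>n. u n x) \<longlonglongrightarrow> v x" and s: "\<sigma> \<longlonglongrightarrow> s"
  shows "gagliardo s UNIV v \<le> liminf (\<lambda>n. gagliardo (\<sigma> n) UNIV (u n))"
proof -
  let ?f = "\<lambda>s u r x. ennreal (2 * ((u (x + r) - u x)\<^sup>2 * (r powr - (1 + 2 * s) * indicator {0<..} r)))"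
  have inner: "(\<integral>\<^sup>+x. ?f s v r x \<partial>lborel) \<le> liminf (\<lambda>n. \<integral>\<^sup>+x. ?f (\<sigma> n) (u n) r x \<partial>lborel)" for r :: real
  proof -
    have "(\<integral>\<^sup>+x. ?f s v r x \<partial>lborel) = (\<integral>\<^sup>+x. liminf (\<lambda>n. ?f (\<sigma> n) (u n) r x) \<partial>lborel)"
    proof (rule nn_integral_cong_AE, rule AE_I')
      show "C \<union> (\<lambda>x. x - r) ` C \<in> null_sets lborel"
        using C(1) by (intro countable_imp_null_set_lborel) auto
      show "{x \<in> space lborel. ?f s v r x \<noteq> liminf (\<lambda>n. ?f (\<sigma> n) (u n) r x)} \<subseteq> C \<union> (\<lambda>x. x - r) ` C"
      proof (intro subsetI, rule ccontr)
        fix x assume x: "x \<in> {x \<in> space lborel. ?f s v r x \<noteq> liminf (\<lambda>n. ?f (\<sigma> n) (u n) r x)}"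
          and n: "x \<notin> C \<union> (\<lambda>x. x - r) ` C"
        have "x + r \<notin> C"
        proof
          assume "x + r \<in> C"
          then have "x + r - r \<in> (\<lambda>x. x - r) ` C" by (rule imageI)
          then show False using n by simp
        qed
        then have "(\<lambda>n. u n (x + r)) \<longlonglongrightarrow> v (x + r)" "(\<lambda>n. u n x) \<longlonglongrightarrow> v x"
          using n C(2) by auto
        moreover have "(\<lambda>n. r powr - (1 + 2 * \<sigma> n) * indicator {0<..} r) \<longlonglongrightarrow> r powr - (1 + 2 * s) * indicator {0<..} r"
          using s by (cases "0 < r") (auto intro!: tendsto_intros)
        ultimately have "(\<lambda>n. ?f (\<sigma> n) (u n) r x) \<longlonglongrightarrow> ?f s v r x"
          by (rule tendsto_ennrealI[OF tendsto_mult[OF tendsto_const tendsto_mult[OF tendsto_power[OF tendsto_diff]]]])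
        from lim_imp_Liminf[OF _ this] x show False by simp
      qed
    qed
    also have "\<dots> \<le> liminf (\<lambda>n. \<integral>\<^sup>+x. ?f (\<sigma> n) (u n) r x \<partial>lborel)"
      by (rule nn_integral_liminf) simp
    finally show ?thesis .
  qed
  have "gagliardo s UNIV v \<le> (\<integral>\<^sup>+r. liminf (\<lambda>n. \<integral>\<^sup>+x. ?f (\<sigma> n) (u n) r x \<partial>lborel) \<partial>lborel)"
    unfolding gagliardo_eq_iterated[OF m(2)] by (intro nn_integral_mono inner)
  also have "\<dots> \<le> liminf (\<lambda>n. \<integral>\<^sup>+r. \<integral>\<^sup>+x. ?f (\<sigma> n) (u n) r x \<partial>lborel \<partial>lborel)"
    by (rule nn_integral_liminf) measurable
  finally show ?thesis unfolding gagliardo_eq_iterated[OF m(1)] .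
qed

section \<open>Symmetries and submodularity of the seminorm\<close>

lemma gagliardo_shift:
  assumes [measurable]: "u \<in> borel_measurable borel"
  shows "gagliardo s UNIV (\<lambda>x. u (x + a)) = gagliardo s UNIV u"
proof -
  have "sqdiff (\<lambda>x. u (x + a)) r = sqdiff u r" for r
  proof -
    have "(\<integral>\<^sup>+x. (\<lambda>x. ennreal ((u (x + r) - u x)\<^sup>2)) (x + a) \<partial>lborel) = (\<integral>\<^sup>+x. ennreal ((u (x + r) - u x)\<^sup>2) \<partial>lborel)"
      by (rule nn_integral_lborel_shift) measurable
    then show ?thesis by (simp add: sqdiff_def algebra_simps)
  qed
  then show ?thesis by (simp add: gagliardo_eq)
qed

lemma gagliardo_point_reflection:
  assumes [measurable]: "u \<in> borel_measurable borel"
  shows "gagliardo s UNIV (\<lambda>x. - u (- x)) = gagliardo s UNIV u"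
proof -
  have "sqdiff (\<lambda>x. - u (- x)) r = sqdiff u r" for r
  proof -
    have "(\<integral>\<^sup>+x. (\<lambda>x. ennreal ((u (x - r) - u x)\<^sup>2)) (- x) \<partial>lborel) = (\<integral>\<^sup>+x. ennreal ((u (x - r) - u x)\<^sup>2) \<partial>lborel)"
      by (rule nn_integral_lborel_reflect) measurable
    also have "\<dots> = sqdiff u (- r)" by (simp add: sqdiff_def)
    also have "\<dots> = sqdiff u r" by (rule sqdiff_minus) simp
    finally show ?thesis by (simp add: sqdiff_def power2_commute add.commute)
  qed
  then show ?thesis by (simp add: gagliardo_eq)
qed

text \<open>If the pairs (a, c) and (b, d) are ordered alike, the two sides are equal. Otherwise the
  right side exceeds the left by 2(a - c)(d - b), a product of factors of equal sign.\<close>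

lemma max_min_square_le:
  fixes a b c d :: real
  shows "(max a c - max b d)\<^sup>2 + (min a c - min b d)\<^sup>2 \<le> (a - b)\<^sup>2 + (c - d)\<^sup>2"
proof -
  have "0 \<le> 2 * ((a - c) * (d - b))" if "c \<le> a" "b \<le> d" using that by simp
  moreover have "0 \<le> 2 * ((c - a) * (b - d))" if "a \<le> c" "d \<le> b" using that by simp
  ultimately show ?thesis
    by (auto simp: max_def min_def power2_eq_square algebra_simps)
qed

lemma gagliardo_submodular:
  assumes [measurable]: "u \<in> borel_measurable borel" "v \<in> borel_measurable borel"
  shows "gagliardo s UNIV (\<lambda>x. max (u x) (v x)) + gagliardo s UNIV (\<lambda>x. min (u x) (v x))
    \<le> gagliardo s UNIV u + gagliardo s UNIV v"
proof -
  let ?g = "\<lambda>u z. ennreal (\<bar>u (fst z) - u (snd z)\<bar>\<^sup>2 / \<bar>fst z - snd z\<bar> powr (1 + 2 * s))"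
  have "(\<integral>\<^sup>+z. ?g (\<lambda>x. max (u x) (v x)) z \<partial>(lborel \<Otimes>\<^sub>M lborel)) + (\<integral>\<^sup>+z. ?g (\<lambda>x. min (u x) (v x)) z \<partial>(lborel \<Otimes>\<^sub>M lborel))
    = (\<integral>\<^sup>+z. ?g (\<lambda>x. max (u x) (v x)) z + ?g (\<lambda>x. min (u x) (v x)) z \<partial>(lborel \<Otimes>\<^sub>M lborel))"
    by (rule nn_integral_add[symmetric]) measurable
  also have "\<dots> \<le> (\<integral>\<^sup>+z. ?g u z + ?g v z \<partial>(lborel \<Otimes>\<^sub>M lborel))"
    using max_min_square_le
    by (intro nn_integral_mono) (simp add: ennreal_plus[symmetric] add_divide_distrib[symmetric] divide_right_mono ennreal_leI del: ennreal_plus)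
  also have "\<dots> = (\<integral>\<^sup>+z. ?g u z \<partial>(lborel \<Otimes>\<^sub>M lborel)) + (\<integral>\<^sup>+z. ?g v z \<partial>(lborel \<Otimes>\<^sub>M lborel))"
    by (rule nn_integral_add) measurable
  finally show ?thesis by (simp add: gagliardo_def)
qed

text \<open>It serves both as the truncation of arbitrary competitors to [-1, 1] and as the explicit
  ramp used as a competitor.\<close>

definition clamp1 :: "real \<Rightarrow> real" where "clamp1 x = max (-1) (min 1 x)"

lemma clamp1_lipschitz: "\<bar>clamp1 x - clamp1 y\<bar> \<le> \<bar>x - y\<bar>"
  by (auto simp: clamp1_def max_def min_def)

lemma plateau_clamp1: "plateau 1 clamp1"
  by (auto simp: plateau_def clamp1_def)

lemma measurable_clamp1 [measurable]: "clamp1 \<in> borel_measurable borel"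
  unfolding clamp1_def[abs_def] by measurable

lemma continuous_on_clamp1 [continuous_intros]: "continuous_on A f \<Longrightarrow> continuous_on A (\<lambda>x. clamp1 (f x))"
  unfolding clamp1_def by (intro continuous_intros)

lemma gagliardo_clamp1:
  assumes "1/2 < s" "s < 1"
  shows "gagliardo s UNIV clamp1 \<le> ennreal (6 / (2 - 2 * s) + 8 / (2 * s - 1) + 8 / s)"
  using gagliardo_lipschitz_plateau[OF plateau_clamp1 measurable_clamp1, of 1 s] assms clamp1_lipschitz by simp

text \<open>The truncations at 1 - 1 / (n + 1) converge pointwise to the ramp. If each of them lost
  at least e, lower semicontinuity would bound the finite seminorm of the ramp by itself minus
  e.\<close>

lemma gagliardo_clamp1_cut:
  assumes s: "1/2 < s" "s < 1" and e: "0 < e"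
  obtains \<eta> where "0 < \<eta>" "gagliardo s UNIV clamp1 \<le> gagliardo s UNIV (\<lambda>x. min (clamp1 x) (1 - \<eta>)) + ennreal e"
proof -
  let ?g = "\<lambda>n::nat. gagliardo s UNIV (\<lambda>x. min (clamp1 x) (1 - 1 / real (Suc n)))"
  define G where "G = gagliardo s UNIV clamp1"
  have Gf: "G < \<infinity>" unfolding G_def using gagliardo_clamp1[OF s] by (rule le_less_trans) simp
  have "\<exists>n. G \<le> ?g n + ennreal e"
  proof (rule ccontr)
    assume "\<not> ?thesis"
    then have *: "?g n + ennreal e \<le> G" for n by (auto simp: not_le intro: less_imp_le)
    have "G \<le> liminf ?g"
      unfolding G_def
    proof (rule gagliardo_fatou[of _ _ "{}"])
      fix x :: real
      have "(\<lambda>n. min (clamp1 x) (1 - 1 / real (Suc n))) \<longlonglongrightarrow> min (clamp1 x) (1 - 0)"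
        by (intro tendsto_intros LIMSEQ_inverse_real_of_nat[unfolded inverse_eq_divide])
      then show "(\<lambda>n. min (clamp1 x) (1 - 1 / real (Suc n))) \<longlonglongrightarrow> clamp1 x"
        by (simp add: clamp1_def min_def max_def split: if_splits)
    qed simp_all
    also have "\<dots> \<le> G - ennreal e"
      using * by (intro Liminf_le always_eventually allI ennreal_le_minus_iff[THEN iffD2]) (auto simp: add.commute)
    finally have "G \<le> G - ennreal e" .
    \<comment> \<open>Subtraction in \<open>ennreal\<close> stops at 0, so G \<le> G - e is
      contradictory only once e \<le> G is known.\<close>
    moreover have "ennreal e \<le> G" using *[of 0] by (rule order_trans[rotated]) simp
    ultimately show False using Gf e
      by (cases G) (auto simp: ennreal_minus)
  qed
  then obtain n where "G \<le> ?g n + ennreal e" ..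
  then show ?thesis by (intro that[of "1 / real (Suc n)"]) (simp_all add: G_def)
qed


section \<open>Reduction to Lipschitz competitors\<close>

lemma cut_right:
  assumes W: "continuous_on UNIV W" "\<And>z. 0 \<le> W z" "W 1 = 0"
    and u: "continuous_on UNIV u" "\<And>x. \<bar>u x\<bar> \<le> 1" "(u \<longlongrightarrow> 1) at_top"
    and s: "1/2 < s" "s < 1" and fin: "gagliardo s UNIV u < \<infinity>" and e: "0 < e"
  obtains v T where "continuous_on UNIV v" "\<And>x. \<bar>v x\<bar> \<le> 1" "\<And>x. T + 2 \<le> x \<Longrightarrow> v x = 1"
    "\<And>x. x \<le> T \<Longrightarrow> v x = u x" "energy W s v \<le> energy W s u + ennreal e" "gagliardo s UNIV v < \<infinity>"
proof -
  have [measurable]: "u \<in> borel_measurable borel" "W \<in> borel_measurable borel"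
    using W(1) u(1) by (auto intro: borel_measurable_continuous_onI)
  obtain \<eta> where \<eta>: "0 < \<eta>" "gagliardo s UNIV clamp1 \<le> gagliardo s UNIV (\<lambda>x. min (clamp1 x) (1 - \<eta>)) + ennreal (e / 2)"
    using gagliardo_clamp1_cut[OF s, of "e / 2"] e by auto
  have "isCont W 1" using W(1) by (simp add: continuous_on_eq_continuous_at)
  then have "\<forall>\<^sub>F z in at 1. W z < e / 4"
    using order_tendstoD(2)[of W "W 1" "at 1" "e / 4"] W(3) e by (simp add: isCont_def)
  then obtain \<delta> where \<delta>: "0 < \<delta>" "\<And>z. \<bar>z - 1\<bar> < \<delta> \<Longrightarrow> W z \<le> e / 4"
    using W(3) e unfolding eventually_at by (metis dist_real_def less_eq_real_def divide_pos_pos zero_less_numeral UNIV_I)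
  \<comment> \<open>Values above 1 - \<eta> are for the comparison of truncated ramps, which costs e
    / 2 of seminorm. Values above 1 - \<delta> keep the potential at most e / 4 on the ramp's
    interval of length 2, which costs the other e / 2.\<close>
  have "\<forall>\<^sub>F x in at_top. max (1 - \<eta>) (1 - \<delta>) < u x"
    using \<eta>(1) \<delta>(1) by (intro order_tendstoD(1)[OF u(3)]) auto
  then obtain T where T: "\<And>x. T \<le> x \<Longrightarrow> max (1 - \<eta>) (1 - \<delta>) < u x"
    by (auto simp: eventually_at_top_linorder)
  define p where "p x = clamp1 (x + (- T - 1))" for x
  define v where "v x = max (u x) (p x)" for x
  have [measurable]: "p \<in> borel_measurable borel" "v \<in> borel_measurable borel"
    unfolding p_def[abs_def] v_def[abs_def] by measurable
  have p: "\<bar>p x\<bar> \<le> 1" "T + 2 \<le> x \<Longrightarrow> p x = 1" "x \<le> T \<Longrightarrow> p x = -1" for x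
    by (auto simp: p_def clamp1_def)
  have p_shift: "gagliardo s UNIV p = gagliardo s UNIV clamp1"
    unfolding p_def[abs_def] by (rule gagliardo_shift) simp
  have min_shift: "gagliardo s UNIV (\<lambda>x. min (p x) (1 - \<eta>)) = gagliardo s UNIV (\<lambda>x. min (clamp1 x) (1 - \<eta>))"
    unfolding p_def[abs_def] by (rule gagliardo_shift[of "\<lambda>x. min (clamp1 x) (1 - \<eta>)"]) simp
  have sub: "gagliardo s UNIV v + gagliardo s UNIV (\<lambda>x. min (u x) (p x)) \<le> gagliardo s UNIV u + gagliardo s UNIV p"
    unfolding v_def[abs_def] by (rule gagliardo_submodular) simp_all
  \<comment> \<open>The minimum of \<open>u\<close> and the ramp still carries almost all of the energy of the ramp:
    truncating it from above at \<open>1 - \<eta>\<close> yields the truncated ramp.\<close>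
  have "gagliardo s UNIV (\<lambda>x. min (p x) (1 - \<eta>)) \<le> gagliardo s UNIV (\<lambda>x. min (u x) (p x))"
  proof (rule gagliardo_contraction)
    have "min (p x) (1 - \<eta>) = min (min (u x) (p x)) (1 - \<eta>)" for x
      using T[of x] p(3)[of x] u(2)[of x] by (cases "T \<le> x") (auto simp: min_def abs_le_iff)
    then show "\<bar>min (p x) (1 - \<eta>) - min (p y) (1 - \<eta>)\<bar> \<le> \<bar>min (u x) (p x) - min (u y) (p y)\<bar>" for x y
      by (simp only:) (auto simp: min_def)
  qed
  then have ps: "gagliardo s UNIV p \<le> gagliardo s UNIV (\<lambda>x. min (u x) (p x)) + ennreal (e / 2)"
    using \<eta>(2) p_shift min_shift by (auto intro: order_trans add_right_mono)
  have pf: "gagliardo s UNIV p < \<infinity>"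
    unfolding p_shift using gagliardo_clamp1[OF s] by (rule le_less_trans) simp
  have sumf: "gagliardo s UNIV v + gagliardo s UNIV (\<lambda>x. min (u x) (p x)) < \<infinity>"
    using sub by (rule le_less_trans) (use fin pf in auto)
  then have minf: "gagliardo s UNIV (\<lambda>x. min (u x) (p x)) < \<infinity>" and vf: "gagliardo s UNIV v < \<infinity>"
    by auto
  \<comment> \<open>The seminorm of the minimum now stands on both sides and is finite, so it can be
    cancelled.\<close>
  have "gagliardo s UNIV (\<lambda>x. min (u x) (p x)) + gagliardo s UNIV v
    \<le> gagliardo s UNIV (\<lambda>x. min (u x) (p x)) + (gagliardo s UNIV u + ennreal (e / 2))"
    using order_trans[OF sub add_left_mono[OF ps]] by (simp only: add_ac)
  then have G: "gagliardo s UNIV v \<le> gagliardo s UNIV u + ennreal (e / 2)"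
    using minf by (auto simp: ennreal_add_left_cancel_le)
  have "(\<integral>\<^sup>+x. ennreal (W (v x)) \<partial>lborel) \<le> (\<integral>\<^sup>+x. ennreal (W (u x)) + ennreal (e / 4) * indicator {T..T + 2} x \<partial>lborel)"
  proof (rule nn_integral_mono)
    fix x
    consider "x < T" | "T \<le> x" "x \<le> T + 2" | "T + 2 < x" by linarith
    then show "ennreal (W (v x)) \<le> ennreal (W (u x)) + ennreal (e / 4) * indicator {T..T + 2} x"
    proof cases
      case 1
      then have "v x = u x" using p(3)[of x] u(2)[of x] by (auto simp: v_def max_def abs_le_iff)
      then show ?thesis by simp
    next
      case 2
      have "1 - \<delta> < v x" "v x \<le> 1" using T[OF 2(1)] u(2)[of x] p(1)[of x] by (auto simp: v_def)
      then have "W (v x) \<le> e / 4" by (intro \<delta>(2)) auto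
      then show ?thesis using 2 by (simp add: ennreal_leI add_increasing)
    next
      case 3
      then have "v x = 1" using p(2)[of x] u(2)[of x] by (auto simp: v_def max_def abs_le_iff)
      then show ?thesis using W(3) by simp
    qed
  qed
  also have "\<dots> = (\<integral>\<^sup>+x. ennreal (W (u x)) \<partial>lborel) + ennreal (e / 2)"
    using e by (simp add: nn_integral_add nn_integral_cmult_indicator ennreal_mult[symmetric] del: ennreal_numeral flip: ennreal_numeral)
  finally have "energy W s v \<le> ((\<integral>\<^sup>+x. ennreal (W (u x)) \<partial>lborel) + ennreal (e / 2)) + (gagliardo s UNIV u + ennreal (e / 2))"
    unfolding energy_def using G by (rule add_mono)
  also have "\<dots> = energy W s u + (ennreal (e / 2) + ennreal (e / 2))" by (simp add: energy_def ac_simps)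
  also have "ennreal (e / 2) + ennreal (e / 2) = ennreal e" using e by (subst ennreal_plus[symmetric]) auto
  finally have en: "energy W s v \<le> energy W s u + ennreal e" .
  show ?thesis
  proof (rule that[of v T])
    show "continuous_on UNIV v" unfolding v_def[abs_def] p_def by (intro continuous_intros u(1))
    show "\<bar>v x\<bar> \<le> 1" for x using u(2)[of x] p(1)[of x] by (auto simp: v_def)
    show "v x = 1" if "T + 2 \<le> x" for x using p(2)[OF that] u(2)[of x] by (auto simp: v_def max_def abs_le_iff)
    show "v x = u x" if "x \<le> T" for x using p(3)[OF that] u(2)[of x] by (auto simp: v_def max_def abs_le_iff)
  qed (use en vf in auto)
qed

lemma energy_point_reflection:
  assumes [measurable]: "u \<in> borel_measurable borel" "W \<in> borel_measurable borel"
  shows "energy (\<lambda>z. W (- z)) s (\<lambda>x. - u (- x)) = energy W s u"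
proof -
  have "(\<integral>\<^sup>+x. (\<lambda>x. ennreal (W (u x))) (- x) \<partial>lborel) = (\<integral>\<^sup>+x. ennreal (W (u x)) \<partial>lborel)"
    by (rule nn_integral_lborel_reflect) measurable
  then show ?thesis by (simp add: energy_def gagliardo_point_reflection)
qed

text \<open>Clamping to [-1, 1] lowers both energy terms, because W vanishes at the two ends. One
  cut makes the right end constant; the point reflection x \<mapsto> -u(-x), with W(-z) as
  potential, brings the left end to the right for a second cut.\<close>

lemma exists_plateau:
  assumes W: "continuous_on UNIV W" "\<And>z. 0 \<le> W z" "W 1 = 0" "W (-1) = 0"
    and u: "u \<in> transitions s" and s: "1/2 < s" "s < 1" and fin: "energy W s u < \<infinity>" and e: "0 < e"
  obtains v T where "continuous_on UNIV v" "plateau T v" "energy W s v \<le> energy W s u + ennreal e"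
proof -
  have [measurable]: "W \<in> borel_measurable borel" using W(1) by (rule borel_measurable_continuous_onI)
  have [measurable]: "u \<in> borel_measurable borel" using transitionsD(2)[OF u] .
  define u1 where "u1 x = clamp1 (u x)" for x
  have c1: "continuous_on UNIV u1" unfolding u1_def[abs_def] by (intro continuous_intros transitionsD[OF u])
  have b1: "\<bar>u1 x\<bar> \<le> 1" for x by (simp add: u1_def clamp1_def)
  have "isCont clamp1 z" for z
    using continuous_on_clamp1[OF continuous_on_id, of UNIV] by (simp add: continuous_on_eq_continuous_at)
  then have l1: "(u1 \<longlongrightarrow> clamp1 1) at_top" "(u1 \<longlongrightarrow> clamp1 (-1)) at_bot"
    unfolding u1_def[abs_def] using transitionsD(3,4)[OF u] by (auto intro: isCont_tendsto_compose)
  have "W (clamp1 z) \<le> W z" for z using W(2,3,4) by (auto simp: clamp1_def max_def min_def)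
  then have "(\<integral>\<^sup>+x. ennreal (W (u1 x)) \<partial>lborel) \<le> (\<integral>\<^sup>+x. ennreal (W (u x)) \<partial>lborel)"
    unfolding u1_def by (intro nn_integral_mono ennreal_leI)
  moreover have G1: "gagliardo s UNIV u1 \<le> gagliardo s UNIV u"
    unfolding u1_def using clamp1_lipschitz by (rule gagliardo_contraction)
  ultimately have en1: "energy W s u1 \<le> energy W s u" unfolding energy_def by (rule add_mono)
  have "gagliardo s UNIV u1 < \<infinity>"
    using G1 fin by (auto simp: energy_def intro: le_less_trans)
  from cut_right[OF W(1-3) c1 b1 _ s this, of "e / 2"] l1 e
  obtain u2 T2 where u2: "continuous_on UNIV u2" "\<And>x. \<bar>u2 x\<bar> \<le> 1" "\<And>x. T2 + 2 \<le> x \<Longrightarrow> u2 x = 1"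
    "\<And>x. x \<le> T2 \<Longrightarrow> u2 x = u1 x" "energy W s u2 \<le> energy W s u1 + ennreal (e / 2)" "gagliardo s UNIV u2 < \<infinity>"
    by (auto simp: clamp1_def)
  have [measurable]: "u2 \<in> borel_measurable borel" using u2(1) by (rule borel_measurable_continuous_onI)
  have "(u2 \<longlongrightarrow> -1) at_bot"
  proof (rule Lim_transform_eventually)
    show "(u1 \<longlongrightarrow> -1) at_bot" using l1(2) by (simp add: clamp1_def)
    show "\<forall>\<^sub>F x in at_bot. u1 x = u2 x" using u2(4) by (auto intro!: eventually_at_bot_linorderI[of T2])
  qed
  then have l2: "((\<lambda>x. - u2 (- x)) \<longlongrightarrow> 1) at_top"
    using tendsto_minus[OF filterlim_compose[OF _ filterlim_uminus_at_bot_at_top, of u2 "nhds (-1)"]] by simp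
  have c2: "continuous_on UNIV (\<lambda>x. - u2 (- x))"
    by (intro continuous_intros continuous_on_compose2[OF u2(1)]) auto
  have cW: "continuous_on UNIV (\<lambda>z. W (- z))"
    by (intro continuous_on_compose2[OF W(1)] continuous_intros) auto
  have G2: "gagliardo s UNIV (\<lambda>x. - u2 (- x)) < \<infinity>"
    using u2(6) gagliardo_point_reflection[of u2 s] by simp
  obtain w T3 where w: "continuous_on UNIV w" "\<And>x. \<bar>w x\<bar> \<le> 1" "\<And>x. T3 + 2 \<le> x \<Longrightarrow> w x = 1"
    "\<And>x. x \<le> T3 \<Longrightarrow> w x = - u2 (- x)"
    "energy (\<lambda>z. W (- z)) s w \<le> energy (\<lambda>z. W (- z)) s (\<lambda>x. - u2 (- x)) + ennreal (e / 2)"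
    by (rule cut_right[OF cW _ _ c2 _ l2 s G2, of "e / 2"]) (use W u2(2) e in auto)
  have [measurable]: "w \<in> borel_measurable borel" using w(1) by (rule borel_measurable_continuous_onI)
  define v where "v x = - w (- x)" for x
  have "energy W s v = energy (\<lambda>z. W (- z)) s w"
    using energy_point_reflection[of w "\<lambda>z. W (- z)" s] by (simp add: v_def[abs_def])
  also have "\<dots> \<le> energy W s u2 + ennreal (e / 2)"
    using w(5) energy_point_reflection[of u2 W s] by simp
  also have "\<dots> \<le> energy W s u1 + ennreal (e / 2) + ennreal (e / 2)"
    using u2(5) by (rule add_right_mono)
  also have "\<dots> = energy W s u1 + ennreal e"
    using e by (simp add: add.assoc ennreal_plus[symmetric] del: ennreal_plus)
  also have "\<dots> \<le> energy W s u + ennreal e" using en1 by (rule add_right_mono)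
  finally have "energy W s v \<le> energy W s u + ennreal e" .
  moreover have "continuous_on UNIV v"
    unfolding v_def[abs_def] by (intro continuous_intros continuous_on_compose2[OF w(1)]) auto
  \<comment> \<open>To the left of -(T3 + 2) the second ramp is complete. To the right of -T3 the
    second cut changed nothing, so v agrees with u2 there and equals 1 from T2 + 2 on.\<close>
  moreover have "plateau (max (T3 + 2) (max (- T3) (T2 + 2))) v"
    unfolding plateau_def v_def using w(2,3,4) u2(3) by (auto simp: le_minus_iff minus_le_iff)
  ultimately show ?thesis using that by blast
qed

section \<open>Smoothing by averages over short windows\<close>

lemma exists_antiderivative:
  fixes u :: "real \<Rightarrow> real"
  assumes "continuous_on UNIV u"
  obtains U where "\<And>x. DERIV U x :> u x"
proof -
  have "isCont u x" for x using assms by (simp add: continuous_on_eq_continuous_at)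
  then have "\<exists>F. \<forall>x::real. -\<infinity> < ereal x \<longrightarrow> ereal x < \<infinity> \<longrightarrow> (F has_vector_derivative u x) (at x)"
    by (intro einterval_antiderivative) auto
  then show ?thesis using that by (auto simp: has_real_derivative_iff_has_vector_derivative)
qed

text \<open>The increment of the average is the average over [x, x + h] of the increment w of u.
  Jensen's inequality bounds its square by the average of w^2, and by Tonelli each point t receives
  total weight h / h = 1.\<close>

lemma sqdiff_average_le:
  assumes c: "continuous_on UNIV u" and U: "\<And>x. DERIV U x :> u x" and h: "0 < h"
  shows "sqdiff (\<lambda>x. (U (x + h) - U x) / h) r \<le> sqdiff u r"
proof -
  define w where "w x = u (x + r) - u x" for x
  define V where "V x = U (x + r) - U x" for x
  have V: "DERIV V x :> w x" for x
    unfolding V_def w_def by (auto intro!: derivative_eq_intros U DERIV_shift[THEN iffD1])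
  have cw: "continuous_on UNIV w"
    unfolding w_def[abs_def] by (intro continuous_intros c continuous_on_compose2[OF c]) auto
  have [measurable]: "w \<in> borel_measurable borel" using cw by (rule borel_measurable_continuous_onI)
  obtain Q where Q: "\<And>x. DERIV Q x :> (w x)\<^sup>2"
    by (rule exists_antiderivative[of "\<lambda>x. (w x)\<^sup>2"]) (use cw in \<open>auto intro: continuous_intros\<close>)
  have jensen: "ennreal (((V (x + h) - V x) / h)\<^sup>2) \<le> ennreal (1 / h) * (\<integral>\<^sup>+t. ennreal ((w t)\<^sup>2) * indicator {x..x + h} t \<partial>lborel)" for x
  proof -
    define m where "m = (V (x + h) - V x) / h"
    \<comment> \<open>an antiderivative of \<open>(w - m)\<^sup>2\<close>\<close>
    define R where "R y = Q y - 2 * m * V y + m\<^sup>2 * y" for y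
    have "R x \<le> R (x + h)"
    proof (rule DERIV_nonneg_imp_nondecreasing[where f = R])
      fix y
      have "DERIV R y :> (w y - m)\<^sup>2"
        unfolding R_def by (auto intro!: derivative_eq_intros Q V simp: power2_eq_square algebra_simps)
      then show "\<exists>d. DERIV R y :> d \<and> 0 \<le> d" by (intro exI[of _ "(w y - m)\<^sup>2"]) simp
    qed (use h in simp)
    moreover have "V (x + h) - V x = m * h" using h by (simp add: m_def)
    ultimately have "m\<^sup>2 * h \<le> Q (x + h) - Q x"
      by (simp add: R_def power2_eq_square algebra_simps)
    then have "m\<^sup>2 \<le> 1 / h * (Q (x + h) - Q x)" using h by (simp add: field_simps)
    moreover have "(\<integral>\<^sup>+t. ennreal ((w t)\<^sup>2) * indicator {x..x + h} t \<partial>lborel) = ennreal (Q (x + h) - Q x)"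
      using h by (intro nn_integral_FTC_Icc) (auto intro: Q)
    ultimately show ?thesis using h by (simp add: m_def ennreal_mult'[symmetric] ennreal_leI)
  qed
  have "sqdiff (\<lambda>x. (U (x + h) - U x) / h) r = (\<integral>\<^sup>+x. ennreal (((V (x + h) - V x) / h)\<^sup>2) \<partial>lborel)"
    unfolding sqdiff_def V_def by (intro nn_integral_cong) (simp add: diff_divide_distrib add_divide_distrib algebra_simps)
  also have "\<dots> \<le> (\<integral>\<^sup>+x. ennreal (1 / h) * (\<integral>\<^sup>+t. ennreal ((w t)\<^sup>2) * indicator {x..x + h} t \<partial>lborel) \<partial>lborel)"
    by (intro nn_integral_mono jensen)
  also have "\<dots> = ennreal (1 / h) * (\<integral>\<^sup>+x. (\<integral>\<^sup>+t. ennreal ((w t)\<^sup>2) * indicator {x..x + h} t \<partial>lborel) \<partial>lborel)"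
    by (rule nn_integral_cmult) (simp add: indicator_def)
  also have "(\<integral>\<^sup>+x. (\<integral>\<^sup>+t. ennreal ((w t)\<^sup>2) * indicator {x..x + h} t \<partial>lborel) \<partial>lborel)
      = (\<integral>\<^sup>+t. (\<integral>\<^sup>+x. ennreal ((w t)\<^sup>2) * indicator {x..x + h} t \<partial>lborel) \<partial>lborel)"
    by (rule lborel_pair.Fubini') (simp add: indicator_def)
  also have "\<dots> = (\<integral>\<^sup>+t. (\<integral>\<^sup>+x. ennreal ((w t)\<^sup>2) * indicator {t - h..t} x \<partial>lborel) \<partial>lborel)"
    by (intro nn_integral_cong) (auto simp: indicator_def)
  also have "\<dots> = (\<integral>\<^sup>+t. ennreal ((w t)\<^sup>2) * ennreal h \<partial>lborel)"
    using h by (simp add: nn_integral_cmult_indicator)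
  also have "\<dots> = (\<integral>\<^sup>+t. ennreal ((w t)\<^sup>2) \<partial>lborel) * ennreal h"
    by (rule nn_integral_multc) measurable
  also have "(\<integral>\<^sup>+t. ennreal ((w t)\<^sup>2) \<partial>lborel) = sqdiff u r" by (simp add: sqdiff_def w_def)
  also have "ennreal (1 / h) * (sqdiff u r * ennreal h) = sqdiff u r * ennreal (1 / h * h)"
    using h by (subst ennreal_mult) (auto simp: mult_ac)
  also have "\<dots> = sqdiff u r" using h by simp
  finally show ?thesis .
qed


lemma continuous_bounded_above_unit:
  fixes W :: "real \<Rightarrow> real"
  assumes "continuous_on UNIV W"
  obtains B where "\<And>z. \<bar>z\<bar> \<le> 1 \<Longrightarrow> W z \<le> B"
proof -
  have "compact (W ` {-1..1})"
    using assms by (intro compact_continuous_image) (auto intro: continuous_on_subset)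
  then obtain B where "\<And>z. \<bar>z\<bar> \<le> 1 \<Longrightarrow> W z \<le> B"
    using compact_imp_bounded[of "W ` {-1..1}"] unfolding bounded_iff
    by (metis abs_le_D1 abs_le_iff atLeastAtMost_iff image_eqI minus_le_iff real_norm_def)
  then show ?thesis by (rule that)
qed

lemma plateau_potential_finite:
  assumes W: "continuous_on UNIV W" "W 1 = 0" "W (-1) = 0" and u: "plateau T u"
  shows "(\<integral>\<^sup>+x. ennreal (W (u x)) \<partial>lborel) < \<infinity>"
proof -
  obtain B where B: "\<And>z. \<bar>z\<bar> \<le> 1 \<Longrightarrow> W z \<le> B"
    using continuous_bounded_above_unit[OF W(1)] by blast
  have "(\<integral>\<^sup>+x. ennreal (W (u x)) \<partial>lborel) \<le> (\<integral>\<^sup>+x. ennreal B * indicator {-T..T} x \<partial>lborel)"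
  proof (rule nn_integral_mono)
    fix x
    show "ennreal (W (u x)) \<le> ennreal B * indicator {-T..T} x"
      using B plateauD(1-3)[OF u, of x] W(2,3) by (cases "x \<in> {-T..T}") (auto intro: ennreal_leI)
  qed
  also have "\<dots> < \<infinity>"
    using plateauD(4)[OF u] by (simp add: nn_integral_cmult_indicator ennreal_mult_less_top)
  finally show ?thesis .
qed

text \<open>Averages of u over [x, x + h] are difference quotients of an antiderivative. Their
  derivative is an increment of u divided by h, hence at most 2 / h in size. Averaging does not
  increase the seminorm, and the potential term converges by dominated convergence as h tends to 0.
  The radius grows by 1 because windows have length at most 1.\<close>

lemma exists_lipschitz_plateau:
  assumes W: "continuous_on UNIV W" "\<And>z. 0 \<le> W z" "W 1 = 0" "W (-1) = 0"
    and u: "continuous_on UNIV u" "plateau T u" and e: "0 < e"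
  obtains v L where "plateau (T + 1) v" "\<And>x y. \<bar>v x - v y\<bar> \<le> L * \<bar>x - y\<bar>"
    "energy W s v \<le> energy W s u + ennreal e"
proof -
  have [measurable]: "u \<in> borel_measurable borel" "W \<in> borel_measurable borel"
    using W(1) u(1) by (auto intro: borel_measurable_continuous_onI)
  obtain U where U: "\<And>x. DERIV U x :> u x" using exists_antiderivative[OF u(1)] by blast
  define h where "h n = 1 / real (Suc n)" for n
  have h: "0 < h n" "h n \<le> 1" for n by (auto simp: h_def)
  define v where "v n x = (U (x + h n) - U x) / h n" for n x
  \<comment> \<open>By the mean value theorem each average is a value of u inside its window, so
    bounds and plateaus pass to it directly.\<close>
  have mv: "\<exists>z. x < z \<and> z < x + h n \<and> v n x = u z" for n x
    using MVT2[of x "x + h n" U u] U h(1)[of n] by (auto simp: v_def)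
  have pv: "plateau (T + 1) (v n)" for n
    unfolding plateau_def
  proof (intro conjI allI impI)
    fix x
    obtain z where z: "x < z" "z < x + h n" "v n x = u z" using mv by blast
    show "\<bar>v n x\<bar> \<le> 1" using z plateauD(1)[OF u(2)] by simp
    show "v n x = 1" if "T + 1 \<le> x" using z that plateauD(2)[OF u(2), of z] by simp
    show "v n x = -1" if "x \<le> - (T + 1)" using z that h(2)[of n] plateauD(3)[OF u(2), of z] by simp
  qed
  have cU: "continuous_on UNIV U" using U by (meson DERIV_isCont continuous_at_imp_continuous_on)
  have cv: "continuous_on UNIV (v n)" for n
    unfolding v_def[abs_def] by (intro continuous_intros continuous_on_compose2[OF cU] cU) (use h[of n] in auto)
  have [measurable]: "v n \<in> borel_measurable borel" for n using cv by (rule borel_measurable_continuous_onI)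
  have G: "gagliardo s UNIV (v n) \<le> gagliardo s UNIV u" for n
  proof (rule gagliardo_mono_sqdiff)
    show "sqdiff (v n) r \<le> sqdiff u r" for r
      unfolding v_def[abs_def] by (rule sqdiff_average_le[OF u(1) U h(1)])
  qed simp_all
  have lip: "\<bar>v n x - v n y\<bar> \<le> 2 / h n * \<bar>x - y\<bar>" for n x y
  proof -
    have "norm (v n x - v n y) \<le> 2 / h n * norm (x - y)"
    proof (rule field_differentiable_bound[where S = UNIV])
      fix z :: real
      show "(v n has_field_derivative (u (z + h n) - u z) / h n) (at z within UNIV)"
      proof -
        have "DERIV (\<lambda>z. U (z + h n)) z :> u (z + h n)"
          using U[of "z + h n"] by (simp add: DERIV_shift)
        then show ?thesis
          unfolding v_def[abs_def] by (intro DERIV_cdivide DERIV_diff U)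
      qed
      have "\<bar>u (z + h n) - u z\<bar> \<le> 2" using plateauD(1)[OF u(2), of z] plateauD(1)[OF u(2), of "z + h n"] by linarith
      then show "norm ((u (z + h n) - u z) / h n) \<le> 2 / h n"
        using h(1)[of n] by (simp add: divide_right_mono)
    qed auto
    then show ?thesis by simp
  qed
  obtain B where B: "\<And>z. \<bar>z\<bar> \<le> 1 \<Longrightarrow> W z \<le> B"
    using continuous_bounded_above_unit[OF W(1)] by blast
  have Wout: "W (w x) = 0" if "plateau (T + 1) w" "x \<notin> {- (T + 1)..T + 1}" for w x
    using that W(3,4) plateauD(2,3)[OF that(1), of x] by auto
  have "(\<lambda>n. \<integral>\<^sup>+x. ennreal (W (v n x)) \<partial>lborel) \<longlonglongrightarrow> (\<integral>\<^sup>+x. ennreal (W (u x)) \<partial>lborel)"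
  proof (rule nn_integral_dominated_convergence)
    show "AE x in lborel. ennreal (W (v n x)) \<le> ennreal B * indicator {- (T + 1)..T + 1} x" for n
      using B plateauD(1)[OF pv] Wout[OF pv] by (intro AE_I2) (auto simp: indicator_def intro: ennreal_leI)
    show "(\<integral>\<^sup>+x. ennreal B * indicator {- (T + 1)..T + 1} x \<partial>lborel) < \<infinity>"
      using plateauD(4)[OF u(2)] by (simp add: nn_integral_cmult_indicator ennreal_mult_less_top)
    have "(\<lambda>n. v n x) \<longlonglongrightarrow> u x" for x
    proof -
      have "((\<lambda>t. (U (x + t) - U x) / t) \<longlongrightarrow> u x) (at 0)" using U[of x] by (simp add: DERIV_def)
      moreover have "filterlim h (at 0) sequentially"
        unfolding filterlim_at h_def using LIMSEQ_inverse_real_of_nat[unfolded inverse_eq_divide] by auto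
      ultimately show ?thesis unfolding v_def by (rule filterlim_compose)
    qed
    moreover have "isCont W z" for z using W(1) by (simp add: continuous_on_eq_continuous_at)
    ultimately have "(\<lambda>n. W (v n x)) \<longlonglongrightarrow> W (u x)" for x by (auto intro: isCont_tendsto_compose)
    then show "AE x in lborel. (\<lambda>n. ennreal (W (v n x))) \<longlonglongrightarrow> ennreal (W (u x))"
      by (intro AE_I2 tendsto_ennrealI)
  qed measurable
  moreover have "(\<integral>\<^sup>+x. ennreal (W (u x)) \<partial>lborel) < (\<integral>\<^sup>+x. ennreal (W (u x)) \<partial>lborel) + ennreal e"
  proof -
    show ?thesis using e plateau_potential_finite[OF W(1,3,4) u(2)] by (cases "\<integral>\<^sup>+x. ennreal (W (u x)) \<partial>lborel") (auto simp: ennreal_plus[symmetric] ennreal_less_iff simp del: ennreal_plus)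
  qed
  ultimately have "\<forall>\<^sub>F n in sequentially. (\<integral>\<^sup>+x. ennreal (W (v n x)) \<partial>lborel) < (\<integral>\<^sup>+x. ennreal (W (u x)) \<partial>lborel) + ennreal e"
    by (rule order_tendstoD)
  then obtain n where "(\<integral>\<^sup>+x. ennreal (W (v n x)) \<partial>lborel) < (\<integral>\<^sup>+x. ennreal (W (u x)) \<partial>lborel) + ennreal e"
    by (auto simp: eventually_sequentially)
  then have "energy W s (v n) \<le> (\<integral>\<^sup>+x. ennreal (W (u x)) \<partial>lborel) + ennreal e + gagliardo s UNIV u"
    unfolding energy_def using G by (intro add_mono) (auto intro: less_imp_le)
  then have "energy W s (v n) \<le> energy W s u + ennreal e" by (simp add: energy_def add_ac)
  then show ?thesis using that[OF pv lip] by blast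
qed

lemma exists_competitor:
  assumes W: "continuous_on UNIV W" "\<And>z. 0 \<le> W z" "W 1 = 0" "W (-1) = 0"
    and s: "1/2 < s" "s < 1" and less: "min_energy W s < c"
  obtains v L T where "plateau T v" "\<And>x y. \<bar>v x - v y\<bar> \<le> L * \<bar>x - y\<bar>" "energy W s v < c"
proof -
  obtain u where u: "u \<in> transitions s" "energy W s u < c"
    using less by (auto simp: min_energy_def INF_less_iff)
  then have fin: "energy W s u < \<infinity>" by (metis infinity_ennreal_def less_top order_less_le_trans top_greatest less_le_not_le)
  \<comment> \<open>The strict inequality must absorb two errors e, one for creating the plateaus
    and one for the smoothing.\<close>
  obtain e where e: "0 < e" "energy W s u + ennreal e + ennreal e < c"
  proof (cases "c = \<infinity>")
    case True then show ?thesis using fin that[of 1] by simp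
  next
    case False
    then obtain c' where c': "c = ennreal c'" "0 \<le> c'" by (cases c) auto
    obtain a where a: "energy W s u = ennreal a" "0 \<le> a" using fin by (cases "energy W s u") auto
    have "a < c'" using u(2) a c' by (simp add: ennreal_less_iff)
    then show ?thesis using a c'
      by (intro that[of "(c' - a) / 4"]) (auto simp: ennreal_plus[symmetric] ennreal_less_iff field_simps simp del: ennreal_plus)
  qed
  obtain v T where v: "continuous_on UNIV v" "plateau T v" "energy W s v \<le> energy W s u + ennreal e"
    using exists_plateau[OF W u(1) s fin e(1)] by blast
  obtain w L where w: "plateau (T + 1) w" "\<And>x y. \<bar>w x - w y\<bar> \<le> L * \<bar>x - y\<bar>" "energy W s w \<le> energy W s v + ennreal e"
    using exists_lipschitz_plateau[OF W v(1,2) e(1)] by blast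
  have "energy W s w \<le> energy W s u + ennreal e + ennreal e"
    using w(3) v(3) by (meson add_right_mono order_trans)
  then show ?thesis using that[OF w(1,2)] e(2) by (auto intro: le_less_trans)
qed

section \<open>Upper semicontinuity of the minimal energy in the exponent\<close>

lemma lipschitz_continuous_on:
  fixes v :: "real \<Rightarrow> real"
  assumes "\<And>x y. \<bar>v x - v y\<bar> \<le> L * \<bar>x - y\<bar>"
  shows "continuous_on UNIV v"
proof -
  have "0 \<le> L" using assms[of 1 0] by simp
  then have "L-lipschitz_on UNIV v" using assms by (intro lipschitz_onI) (auto simp: dist_real_def)
  then show ?thesis by (rule lipschitz_on_continuous_on)
qed

text \<open>One and the same profile is admissible for all exponents, so its continuous energy
  bounds \<open>min_energy\<close> from above on a whole neighbourhood of a given exponent.\<close>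

lemma energy_lipschitz_plateau:
  assumes W: "continuous_on UNIV W" "W 1 = 0" "W (-1) = 0"
    and v: "plateau T v" "\<And>x y. \<bar>v x - v y\<bar> \<le> L * \<bar>x - y\<bar>"
  shows "s \<in> {1/2<..<1} \<Longrightarrow> energy W s v < \<infinity>"
    and "s \<in> {1/2<..<1} \<Longrightarrow> min_energy W s \<le> energy W s v"
    and "continuous_on {1/2<..<1} (\<lambda>s. enn2real (energy W s v))"
proof -
  have c: "continuous_on UNIV v" using v(2) by (rule lipschitz_continuous_on)
  then have m: "v \<in> borel_measurable borel" by (rule borel_measurable_continuous_onI)
  have G: "gagliardo s UNIV v < \<infinity>" if "s \<in> {1/2<..<1}" for s
    using gagliardo_lipschitz_plateau[OF v(1) m v(2), of s] that by (auto intro: le_less_trans)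
  have P: "(\<integral>\<^sup>+x. ennreal (W (v x)) \<partial>lborel) < \<infinity>" using plateau_potential_finite[OF W v(1)] .
  show "energy W s v < \<infinity>" if "s \<in> {1/2<..<1}" for s
    using G[OF that] P by (simp add: energy_def)
  show "min_energy W s \<le> energy W s v" if "s \<in> {1/2<..<1}" for s
    unfolding min_energy_def by (intro INF_lower transitionsI c plateau_limits[OF v(1)] G that)
  have "continuous_on {1/2<..<1} (\<lambda>s. enn2real (\<integral>\<^sup>+x. ennreal (W (v x)) \<partial>lborel) + enn2real (gagliardo s UNIV v))"
    by (intro continuous_intros continuous_on_gagliardo m G)
  then show "continuous_on {1/2<..<1} (\<lambda>s. enn2real (energy W s v))"
    by (rule continuous_on_eq) (use P G in \<open>auto simp: energy_def enn2real_plus\<close>)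
qed

text \<open>The ramp \<open>clamp1\<close> is a competitor for every exponent. Finiteness rules out
  the default value 0 of \<open>enn2real\<close> at infinity.\<close>

lemma min_energy_finite:
  assumes W: "continuous_on UNIV W" "W 1 = 0" "W (-1) = 0" and s: "s \<in> {1/2<..<1}"
  shows "min_energy W s < \<infinity>"
proof -
  have "\<bar>clamp1 x - clamp1 y\<bar> \<le> 1 * \<bar>x - y\<bar>" for x y using clamp1_lipschitz[of x y] by simp
  note E = energy_lipschitz_plateau(1,2)[OF W plateau_clamp1 this s]
  show ?thesis using E(2,1) by (rule le_less_trans)
qed

lemma min_energy_usc:
  assumes W: "continuous_on UNIV W" "\<And>z. 0 \<le> W z" "W 1 = 0" "W (-1) = 0"
    and s: "s \<in> {1/2<..<1}" and c: "enn2real (min_energy W s) < c"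
  shows "\<forall>\<^sub>F \<sigma> in nhds s. enn2real (min_energy W \<sigma>) < c"
proof -
  have less: "min_energy W s < ennreal c"
    using c min_energy_finite[OF W(1,3,4) s] by (cases "min_energy W s") (auto simp: ennreal_less_iff)
  have s': "1/2 < s" "s < 1" using s by auto
  obtain v L T where v: "plateau T v" "\<And>x y. \<bar>v x - v y\<bar> \<le> L * \<bar>x - y\<bar>" "energy W s v < ennreal c"
    by (rule exists_competitor[OF W s' less]) (rule that)
  note E = energy_lipschitz_plateau[OF W(1,3,4) v(1,2)]
  have "isCont (\<lambda>s. enn2real (energy W s v)) s"
    using E(3) s by (simp add: continuous_on_eq_continuous_at)
  then have "((\<lambda>\<sigma>. enn2real (energy W \<sigma> v)) \<longlongrightarrow> enn2real (energy W s v)) (nhds s)"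
    by (simp add: isCont_def tendsto_at_iff_tendsto_nhds[of "\<lambda>s. enn2real (energy W s v)"])
  moreover have "enn2real (energy W s v) < c"
    using v(3) E(1)[OF s] by (cases "energy W s v") (auto simp: ennreal_less_iff)
  ultimately have "\<forall>\<^sub>F \<sigma> in nhds s. enn2real (energy W \<sigma> v) < c"
    by (rule order_tendstoD)
  moreover have "\<forall>\<^sub>F \<sigma> in nhds s. \<sigma> \<in> {1/2<..<1}" using s by (intro eventually_nhds_in_open) auto
  ultimately show ?thesis
  proof eventually_elim
    case (elim \<sigma>)
    have "enn2real (min_energy W \<sigma>) \<le> enn2real (energy W \<sigma> v)"
      using E(1,2)[OF elim(2)] by (intro enn2real_mono) auto
    then show ?case using elim by simp
  qed
qed


section \<open>Lower semicontinuity\<close>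

text \<open>Rearranging a Lipschitz plateau competitor keeps its potential energy and does not
  increase its seminorm. The properties retained are those needed for Helly selection; continuity is
  recovered later, for the limit.\<close>

lemma exists_monotone_competitor:
  assumes W: "continuous_on UNIV W" "\<And>z. 0 \<le> W z" "W 1 = 0" "W (-1) = 0"
    and s: "1/2 < s" "s < 1" and less: "min_energy W s < c"
  obtains w where "mono w" "\<And>x. continuous (at_right x) w" "\<And>x. \<bar>w x\<bar> \<le> 1"
    "\<And>x. 0 \<le> w x \<longleftrightarrow> 0 \<le> x" "energy W s w < c"
proof -
  have [measurable]: "W \<in> borel_measurable borel" using W(1) by (rule borel_measurable_continuous_onI)
  obtain v L T where v: "plateau T v" "\<And>x y. \<bar>v x - v y\<bar> \<le> L * \<bar>x - y\<bar>" "energy W s v < c"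
    by (rule exists_competitor[OF W s less]) (rule that)
  have m[measurable]: "v \<in> borel_measurable borel"
    using lipschitz_continuous_on[OF v(2)] by (rule borel_measurable_continuous_onI)
  have mr[measurable]: "incr_rearr T v \<in> borel_measurable borel"
    by (rule measurable_incr_rearr[OF v(1) m])
  \<comment> \<open>This translation puts the passage through level 0 at the origin, so that the
    transition cannot escape to infinity along a sequence of competitors.\<close>
  define a where "a = shifted_distr T v 0"
  define w where "w x = incr_rearr T v (x + a)" for x
  have "(\<integral>\<^sup>+x. (\<lambda>x. ennreal (W (incr_rearr T v x))) (x + a) \<partial>lborel) = (\<integral>\<^sup>+x. ennreal (W (incr_rearr T v x)) \<partial>lborel)"
    by (rule nn_integral_lborel_shift) measurable
  also have "\<dots> = (\<integral>\<^sup>+x. ennreal (W (v x)) \<partial>lborel)"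
    by (rule nn_integral_incr_rearr[OF v(1) m]) (use W in simp_all)
  finally have P: "(\<integral>\<^sup>+x. ennreal (W (w x)) \<partial>lborel) = (\<integral>\<^sup>+x. ennreal (W (v x)) \<partial>lborel)"
    by (simp add: w_def)
  have "gagliardo s UNIV w = gagliardo s UNIV (incr_rearr T v)"
    unfolding w_def[abs_def] by (rule gagliardo_shift) (rule mr)
  also have "\<dots> \<le> gagliardo s UNIV v"
    by (rule gagliardo_mono_sqdiff[OF mr m sqdiff_incr_rearr_le[OF v(1) m]])
  finally have "energy W s w \<le> energy W s v" unfolding energy_def P by (rule add_left_mono)
  then have en: "energy W s w < c" using v(3) by (rule le_less_trans)
  show ?thesis
  proof (rule that[of w])
    show "mono w" using monoD[OF mono_incr_rearr[OF v(1) m]] by (auto simp: w_def mono_def)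
    show "continuous (at_right x) w" for x
    proof -
      have "filterlim (\<lambda>y. y + a) (at_right (x + a)) (at_right x)"
        unfolding filterlim_at using eventually_at_right_less[of x]
        by (auto intro!: tendsto_intros elim: eventually_mono)
      then show ?thesis
        using continuous_at_right_incr_rearr[OF v(1) m, of "x + a"]
        unfolding continuous_within w_def[abs_def] by (rule filterlim_compose[rotated])
    qed
    show "\<bar>w x\<bar> \<le> 1" for x unfolding w_def by (rule incr_rearr_bounds[OF v(1) m])
    show "0 \<le> w x \<longleftrightarrow> 0 \<le> x" for x
      using incr_rearr_ge_iff[OF v(1) m, of 0 "x + a"] by (simp add: w_def a_def)
  qed (rule en)
qed

text \<open>A jump of height b - a forces \<open>sqdiff F r\<close> to be at least (b - a)^2 r. For
  r \<le> 1 the kernel is at least r^(-2), so the integral dominates that of (b - a)^2 / r, which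
  diverges logarithmically at 0: over [exp(-K), 1] it equals (b - a)^2 K.\<close>

lemma gagliardo_jump:
  assumes m[measurable]: "F \<in> borel_measurable borel" and s: "1/2 \<le> s" and ab: "a < b"
    and F: "\<And>x. x < p \<Longrightarrow> F x \<le> a" "\<And>x. p \<le> x \<Longrightarrow> b \<le> F x"
  shows "gagliardo s UNIV F = \<infinity>"
proof -
  have D: "ennreal ((b - a)\<^sup>2 * r) \<le> sqdiff F r" if r: "0 < r" for r
  proof -
    have "ennreal ((b - a)\<^sup>2 * r) = (\<integral>\<^sup>+x. ennreal ((b - a)\<^sup>2) * indicator {p - r..<p} x \<partial>lborel)"
      using r by (simp add: nn_integral_cmult_indicator ennreal_mult)
    also have "\<dots> \<le> sqdiff F r"
      unfolding sqdiff_def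
    proof (rule nn_integral_mono)
      fix x
      show "ennreal ((b - a)\<^sup>2) * indicator {p - r..<p} x \<le> ennreal ((F (x + r) - F x)\<^sup>2)"
      proof (cases "x \<in> {p - r..<p}")
        case True
        then have "b - a \<le> F (x + r) - F x" using F(1)[of x] F(2)[of "x + r"] by simp
        then have "(b - a)\<^sup>2 \<le> (F (x + r) - F x)\<^sup>2" using ab by (intro power_mono) auto
        then show ?thesis using True by (simp add: ennreal_leI)
      qed simp
    qed
    finally show ?thesis .
  qed
  have K: "ennreal ((b - a)\<^sup>2 * K) \<le> gagliardo s UNIV F" if K: "0 \<le> K" for K
  proof -
    have "(\<integral>\<^sup>+r. ennreal ((b - a)\<^sup>2 / r) * indicator {exp (- K)..1} r \<partial>lborel)
      = ennreal ((\<lambda>r. (b - a)\<^sup>2 * ln r) 1 - (\<lambda>r. (b - a)\<^sup>2 * ln r) (exp (- K)))"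
    proof (rule nn_integral_FTC_Icc)
      fix r assume "r \<in> {exp (- K)..1}"
      then have r: "0 < r" by (auto intro: less_le_trans[OF exp_gt_zero])
      show "((\<lambda>r. (b - a)\<^sup>2 * ln r) has_real_derivative (b - a)\<^sup>2 / r) (at r)"
        using r by (auto intro!: derivative_eq_intros)
      show "0 \<le> (b - a)\<^sup>2 / r" using r by simp
    qed (use K in auto)
    then have "ennreal ((b - a)\<^sup>2 * K) = (\<integral>\<^sup>+r. ennreal ((b - a)\<^sup>2 / r) * indicator {exp (- K)..1} r \<partial>lborel)"
      by simp
    also have "\<dots> \<le> (\<integral>\<^sup>+r\<in>{0<..}. sqdiff F r * ennreal (r powr - (1 + 2 * s)) \<partial>lborel)"
    proof (rule nn_integral_mono)
      fix r :: real
      show "ennreal ((b - a)\<^sup>2 / r) * indicator {exp (- K)..1} r \<le> sqdiff F r * ennreal (r powr - (1 + 2 * s)) * indicator {0<..} r"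
      proof (cases "r \<in> {exp (- K)..1}")
        case True
        then have r: "0 < r" "r \<le> 1" by (auto intro: less_le_trans[OF exp_gt_zero])
        have "r powr - 2 \<le> r powr - (1 + 2 * s)" using r s by (intro powr_mono') auto
        then have "(b - a)\<^sup>2 * r * r powr - 2 \<le> (b - a)\<^sup>2 * r * r powr - (1 + 2 * s)"
          using r by (intro mult_left_mono) auto
        moreover have "(b - a)\<^sup>2 * r * r powr - 2 = (b - a)\<^sup>2 / r"
          using r by (simp add: powr_minus powr_numeral power2_eq_square field_simps)
        ultimately have "ennreal ((b - a)\<^sup>2 / r) \<le> ennreal ((b - a)\<^sup>2 * r) * ennreal (r powr - (1 + 2 * s))"
          using r by (simp add: ennreal_mult[symmetric] ennreal_leI)
        also have "\<dots> \<le> sqdiff F r * ennreal (r powr - (1 + 2 * s))"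
          using D[OF r(1)] by (rule mult_right_mono) simp
        finally show ?thesis using True r by simp
      qed simp
    qed
    also have "\<dots> \<le> gagliardo s UNIV F"
      unfolding gagliardo_eq[OF m] mult_2 by (rule add_increasing) simp_all
    finally show ?thesis .
  qed
  show ?thesis
  proof (rule ccontr)
    assume "gagliardo s UNIV F \<noteq> \<infinity>"
    then obtain g where g: "gagliardo s UNIV F = ennreal g" "0 \<le> g" by (cases "gagliardo s UNIV F") auto
    have "ennreal ((b - a)\<^sup>2 * ((g + 1) / (b - a)\<^sup>2)) \<le> ennreal g"
      unfolding g(1)[symmetric] using g(2) by (intro K) simp
    then show False using g(2) ab by (simp add: ennreal_le_iff)
  qed
qed

text \<open>Only left limits are in question. If F stayed at or below some a < F p to the left of p,
  monotonicity would give a jump at p and hence an infinite seminorm.\<close>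

lemma mono_continuous_of_gagliardo_finite:
  assumes F: "mono F" "\<And>x. continuous (at_right x) F" and s: "1/2 \<le> s" and fin: "gagliardo s UNIV F < \<infinity>"
  shows "continuous_on UNIV F"
proof -
  have m: "F \<in> borel_measurable borel" using F(1) by (rule borel_measurable_mono)
  have "continuous (at_left p) F" for p
    unfolding continuous_within
  proof (rule order_tendstoI)
    fix a assume a: "a < F p"
    have "\<exists>x<p. a < F x"
    proof (rule ccontr)
      assume "\<not> (\<exists>x<p. a < F x)"
      then have "F x \<le> a" if "x < p" for x using that by (metis not_less)
      then have "gagliardo s UNIV F = \<infinity>"
        using monoD[OF F(1)] by (intro gagliardo_jump[OF m s a, of p])
      then show False using fin by simp
    qed
    then obtain x where "x < p" "a < F x" by blast
    then show "\<forall>\<^sub>F y in at_left p. a < F y"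
      using monoD[OF F(1), of x] by (intro eventually_at_leftI[of x]) (auto intro: less_le_trans)
  next
    fix a assume a: "F p < a"
    then show "\<forall>\<^sub>F y in at_left p. F y < a"
      using monoD[OF F(1), of _ p] unfolding eventually_at_filter
      by (intro always_eventually) (auto intro: le_less_trans less_imp_le)
  qed
  then show ?thesis
    using F(2) by (simp add: continuous_on_eq_continuous_at continuous_at_split)
qed

text \<open>Otherwise W(F x) would exceed W(l) / 2 > 0 on a half-line, a set of infinite
  measure.\<close>

lemma potential_zero_of_limit:
  fixes F :: "real \<Rightarrow> real"
  assumes W: "continuous_on UNIV W" "\<And>z. 0 \<le> W z" and F: "(F \<longlongrightarrow> l) at_top"
    and fin: "(\<integral>\<^sup>+x. ennreal (W (F x)) \<partial>lborel) < \<infinity>"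
  shows "W l = 0"
proof (rule ccontr)
  assume "W l \<noteq> 0"
  then have pos: "0 < W l" using W(2)[of l] by linarith
  have "isCont W l" using W(1) by (simp add: continuous_on_eq_continuous_at)
  then have "((\<lambda>x. W (F x)) \<longlongrightarrow> W l) at_top" using F by (rule isCont_tendsto_compose)
  then have "\<forall>\<^sub>F x in at_top. W l / 2 < W (F x)" using pos by (intro order_tendstoD) auto
  then obtain X where X: "\<And>x. X \<le> x \<Longrightarrow> W l / 2 < W (F x)" by (auto simp: eventually_at_top_linorder)
  have "(\<integral>\<^sup>+x. ennreal (W l / 2) * indicator {X..} x \<partial>lborel) \<le> (\<integral>\<^sup>+x. ennreal (W (F x)) \<partial>lborel)"
    using less_imp_le[OF X] by (intro nn_integral_mono) (auto simp: indicator_def intro!: ennreal_leI)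
  moreover have "emeasure lborel {X..} = \<infinity>"
  proof (rule ccontr)
    assume "emeasure lborel {X..} \<noteq> \<infinity>"
    then obtain g where g: "emeasure lborel {X..} = ennreal g" "0 \<le> g" by (cases "emeasure lborel {X..}") auto
    have "emeasure lborel {X..X + (g + 1)} \<le> emeasure lborel {X..}" by (rule emeasure_mono) auto
    then show False using g by (simp add: ennreal_le_iff)
  qed
  ultimately show False using fin pos by (simp add: nn_integral_cmult_indicator ennreal_mult_top)
qed

lemma mono_bounded_tendsto_at_top:
  fixes F :: "real \<Rightarrow> real"
  assumes "mono F" "\<And>x. F x \<le> B"
  obtains l where "(F \<longlongrightarrow> l) at_top" "\<And>x. F x \<le> l" "l \<le> B"
proof -
  have bdd: "bdd_above (range F)" using assms(2) by (auto intro!: bdd_aboveI[of _ B])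
  have up: "F x \<le> Sup (range F)" for x by (rule cSup_upper[OF _ bdd]) simp
  have "(F \<longlongrightarrow> Sup (range F)) at_top"
  proof (rule increasing_tendsto)
    fix y assume "y < Sup (range F)"
    then obtain x where "y < F x" using less_cSup_iff[OF _ bdd] by auto
    then show "\<forall>\<^sub>F z in at_top. y < F z"
      using monoD[OF assms(1)] by (intro eventually_at_top_linorderI[of x]) (auto intro: less_le_trans)
  qed (use up in simp)
  moreover have "Sup (range F) \<le> B" using assms(2) by (intro cSup_least) auto
  ultimately show ?thesis using that up by blast
qed

lemma liminf_add_le_ennreal:
  fixes f g :: "nat \<Rightarrow> ennreal"
  shows "liminf f + liminf g \<le> liminf (\<lambda>n. f n + g n)"
proof -
  have "liminf f + liminf g = (SUP n. (INF i\<in>{n..}. f i) + (INF i\<in>{n..}. g i))"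
    unfolding liminf_SUP_INF
    by (rule ennreal_SUP_add[symmetric]) (auto simp: incseq_def intro!: INF_superset_mono)
  also have "\<dots> \<le> liminf (\<lambda>n. f n + g n)"
    unfolding liminf_SUP_INF by (intro SUP_mono) (auto intro!: INF_greatest add_mono INF_lower)
  finally show ?thesis .
qed

text \<open>Helly selection gives convergence at the continuity points of F, thus off a countable
  set, which suffices for Fatou's lemma in both energy terms. The resulting finite energy makes F
  continuous and forces its limits at both ends into the wells, so F is a competitor at exponent
  s.\<close>

lemma min_energy_le_of_sequence:
  assumes W: "continuous_on UNIV W" "\<And>z. 0 \<le> W z" "\<And>z. W z = 0 \<longleftrightarrow> z = 1 \<or> z = -1"
    and \<sigma>: "\<sigma> \<longlonglongrightarrow> s" "\<And>n. \<sigma> n \<in> {1/2<..<1}" and s: "1/2 < s"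
    and less: "\<And>n. min_energy W (\<sigma> n) < ennreal c"
  shows "min_energy W s \<le> ennreal c"
proof -
  have [measurable]: "W \<in> borel_measurable borel" using W(1) by (rule borel_measurable_continuous_onI)
  have W01: "W 1 = 0" "W (-1) = 0" using W(3) by auto
  have "\<exists>w. mono w \<and> (\<forall>x. continuous (at_right x) w) \<and> (\<forall>x. \<bar>w x\<bar> \<le> 1) \<and> (\<forall>x. 0 \<le> w x \<longleftrightarrow> 0 \<le> x) \<and>
    energy W (\<sigma> n) w < ennreal c" for n
  proof -
    have "1/2 < \<sigma> n" "\<sigma> n < 1" using \<sigma>(2)[of n] by auto
    from exists_monotone_competitor[OF W(1,2) W01 this less] show ?thesis by metis
  qed
  then obtain w where w: "\<And>n. mono (w n)" "\<And>n x. continuous (at_right x) (w n)" "\<And>n x. \<bar>w n x\<bar> \<le> 1"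
    "\<And>n x. 0 \<le> w n x \<longleftrightarrow> 0 \<le> x" "\<And>n. energy W (\<sigma> n) (w n) < ennreal c" by metis
  obtain k F where k: "strict_mono k" and F: "\<And>x. continuous (at_right x) F" "mono F" "\<And>x. \<bar>F x\<bar> \<le> 1"
    and conv: "\<And>x. isCont F x \<Longrightarrow> (\<lambda>n. w (k n) x) \<longlonglongrightarrow> F x"
    using Helly_selection[of w 1, OF w(2,1,3)] by blast
  have [measurable]: "w n \<in> borel_measurable borel" for n using w(1) by (rule borel_measurable_mono)
  have [measurable]: "F \<in> borel_measurable borel" using F(2) by (rule borel_measurable_mono)
  have C: "countable {x. \<not> isCont F x}" using F(2) by (rule mono_ctble_discont)
  have "(\<integral>\<^sup>+x. ennreal (W (F x)) \<partial>lborel) = (\<integral>\<^sup>+x. liminf (\<lambda>n. ennreal (W (w (k n) x))) \<partial>lborel)"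
  proof (rule nn_integral_cong_AE, rule AE_I')
    show "{x. \<not> isCont F x} \<in> null_sets lborel" using C by (rule countable_imp_null_set_lborel)
    have "isCont W z" for z using W(1) by (simp add: continuous_on_eq_continuous_at)
    then have "(\<lambda>n. ennreal (W (w (k n) x))) \<longlonglongrightarrow> ennreal (W (F x))" if "isCont F x" for x
      using conv[OF that] by (intro tendsto_ennrealI) (rule isCont_tendsto_compose)
    then show "{x \<in> space lborel. ennreal (W (F x)) \<noteq> liminf (\<lambda>n. ennreal (W (w (k n) x)))} \<subseteq> {x. \<not> isCont F x}"
      using lim_imp_Liminf[of sequentially] by force
  qed
  also have "\<dots> \<le> liminf (\<lambda>n. \<integral>\<^sup>+x. ennreal (W (w (k n) x)) \<partial>lborel)"
    by (rule nn_integral_liminf) measurable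
  finally have "energy W s F \<le> liminf (\<lambda>n. \<integral>\<^sup>+x. ennreal (W (w (k n) x)) \<partial>lborel) + liminf (\<lambda>n. gagliardo (\<sigma> (k n)) UNIV (w (k n)))"
    unfolding energy_def
    by (rule add_mono, intro gagliardo_fatou[OF _ _ C])
      (use conv LIMSEQ_subseq_LIMSEQ[OF \<sigma>(1) k] in \<open>auto simp: o_def\<close>)
  also have "\<dots> \<le> liminf (\<lambda>n. energy W (\<sigma> (k n)) (w (k n)))"
    unfolding energy_def by (rule liminf_add_le_ennreal)
  also have "\<dots> \<le> ennreal c"
    using w(5) by (intro Liminf_le always_eventually) (auto intro: less_imp_le)
  finally have en: "energy W s F \<le> ennreal c" .
  then have "energy W s F < \<infinity>" by (rule le_less_trans) simp
  then have fin: "(\<integral>\<^sup>+x. ennreal (W (F x)) \<partial>lborel) < \<infinity>" "gagliardo s UNIV F < \<infinity>"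
    by (auto simp: energy_def)
  have cF: "continuous_on UNIV F"
    by (rule mono_continuous_of_gagliardo_finite[OF F(2,1) _ fin(2)]) (use s in simp)
  then have lim: "(\<lambda>n. w (k n) x) \<longlonglongrightarrow> F x" for x by (intro conv) (simp add: continuous_on_eq_continuous_at)
  \<comment> \<open>The normalisation at the origin survives in the limit and selects the wells: F 0
    \<ge> 0 leaves only 1 at the right end, and F(-1) \<le> 0 leaves only -1 at the left end, which
    is treated through -F(-x).\<close>
  have F0: "0 \<le> F 0"
    using w(4) by (intro LIMSEQ_le_const[OF lim[of 0]]) auto
  have Fm: "F (-1) \<le> 0"
    using w(4)[of _ "-1"] by (intro LIMSEQ_le_const2[OF lim[of "-1"]]) (auto simp: not_le intro: less_imp_le)
  have "F x \<le> 1" "- F (- x) \<le> 1" for x using F(3)[of x] F(3)[of "- x"] by (auto simp: abs_le_iff)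
  moreover have "mono (\<lambda>x. - F (- x))" using monoD[OF F(2)] by (auto simp: mono_def)
  ultimately obtain l l' where l: "(F \<longlongrightarrow> l) at_top" "\<And>x. F x \<le> l" and l': "((\<lambda>x. - F (- x)) \<longlongrightarrow> l') at_top" "\<And>x. - F (- x) \<le> l'"
    using mono_bounded_tendsto_at_top[of F 1] mono_bounded_tendsto_at_top[of "\<lambda>x. - F (- x)" 1] F(2) by metis
  have "W l = 0" using potential_zero_of_limit[OF W(1,2) l(1) fin(1)] .
  then have "l = 1" using W(3)[of l] l(2)[of 0] F0 by auto
  have l2: "((\<lambda>x. F (- x)) \<longlongrightarrow> - l') at_top" using tendsto_minus[OF l'(1)] by simp
  have "(\<integral>\<^sup>+x. (\<lambda>x. ennreal (W (F x))) (- x) \<partial>lborel) = (\<integral>\<^sup>+x. ennreal (W (F x)) \<partial>lborel)"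
    by (rule nn_integral_lborel_reflect) measurable
  then have "W (- l') = 0" using potential_zero_of_limit[OF W(1,2) l2] fin(1) by simp
  then have "l' = 1" using W(3)[of "- l'"] l'(2)[of 1] Fm by auto
  have "(F \<longlongrightarrow> -1) at_bot"
    using l2 \<open>l' = 1\<close> by (simp add: filterlim_at_bot_mirror)
  then have "F \<in> transitions s"
    using cF l(1) \<open>l = 1\<close> fin(2) by (intro transitionsI) auto
  then have "min_energy W s \<le> energy W s F" unfolding min_energy_def by (rule INF_lower)
  then show ?thesis using en by (rule order_trans)
qed

lemma min_energy_lsc:
  assumes W: "continuous_on UNIV W" "\<And>z. 0 \<le> W z" "\<And>z. W z = 0 \<longleftrightarrow> z = 1 \<or> z = -1"
    and s: "s \<in> {1/2<..<1}" and c: "c < enn2real (min_energy W s)"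
  shows "\<forall>\<^sub>F \<sigma> in nhds s. c < enn2real (min_energy W \<sigma>)"
proof -
  have W01: "W 1 = 0" "W (-1) = 0" using W(3) by auto
  note fin = min_energy_finite[OF W(1) W01]
  \<comment> \<open>Keeping membership as a premise makes the subsequence that violates the claim
    lie in the open interval, where all minimal energies are finite.\<close>
  have "\<forall>\<^sub>F \<sigma> in nhds s. \<sigma> \<in> {1/2<..<1} \<longrightarrow> c < enn2real (min_energy W \<sigma>)"
    unfolding eventually_nhds_iff_sequentially
  proof (intro allI impI, rule ccontr)
    fix \<sigma> assume \<sigma>: "\<sigma> \<longlonglongrightarrow> s"
    assume "\<not> (\<forall>\<^sub>F n in sequentially. \<sigma> n \<in> {1/2<..<1} \<longrightarrow> c < enn2real (min_energy W (\<sigma> n)))"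
    from not_eventually_sequentiallyD[OF this] obtain k :: "nat \<Rightarrow> nat" where k: "strict_mono k"
      "\<And>n. \<sigma> (k n) \<in> {1/2<..<1}" "\<And>n. enn2real (min_energy W (\<sigma> (k n))) \<le> c"
      by (metis not_less)
    \<comment> \<open>The midpoint lies strictly above the energies along the subsequence and
      strictly below the energy at s.\<close>
    define c' where "c' = (c + enn2real (min_energy W s)) / 2"
    have c': "c < c'" "c' < enn2real (min_energy W s)" using c by (auto simp: c'_def)
    have "min_energy W (\<sigma> (k n)) < ennreal c'" for n
      using k(3)[of n] c'(1) fin[OF k(2)[of n]]
      by (cases "min_energy W (\<sigma> (k n))") (auto simp: ennreal_less_iff)
    then have "min_energy W s \<le> ennreal c'"
      using LIMSEQ_subseq_LIMSEQ[OF \<sigma> k(1)] k(2) s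
      by (intro min_energy_le_of_sequence[OF W, of "\<lambda>n. \<sigma> (k n)"]) (auto simp: o_def)
    moreover have "0 \<le> c'" using k(3)[of 0] c'(1) enn2real_nonneg[of "min_energy W (\<sigma> (k 0))"] by linarith
    ultimately have "enn2real (min_energy W s) \<le> c'" using fin[OF s] by (cases "min_energy W s") auto
    then show False using c'(2) by simp
  qed
  moreover have "\<forall>\<^sub>F \<sigma> in nhds s. \<sigma> \<in> {1/2<..<1}" using s by (intro eventually_nhds_in_open) auto
  ultimately show ?thesis by eventually_elim simp
qed


section \<open>The limit at one half\<close>

text \<open>The explicit antiderivative vanishes at infinity because -2s and 1 - 2s are negative.
  All dependence on L is collected in \<open>L powr (1 - 2 * s)\<close>.\<close>

lemma nn_integral_tail_kernel:
  fixes s L :: real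
  assumes s: "1/2 < s" and L: "0 < L"
  shows "(\<integral>\<^sup>+r. ennreal ((r - L) * r powr - (1 + 2 * s)) * indicator {L..} r \<partial>lborel)
    = ennreal (L powr (1 - 2 * s) * (1 / (2 * s - 1) - 1 / (2 * s)))"
proof -
  define F where "F r = L * (r powr (- 2 * s) / (2 * s)) - r powr (1 - 2 * s) / (2 * s - 1)" for r
  have "(\<integral>\<^sup>+r. ennreal ((r - L) * r powr - (1 + 2 * s)) * indicator {L..} r \<partial>lborel) = ennreal (0 - F L)"
  proof (rule nn_integral_FTC_atLeast)
    fix r assume "L \<le> r"
    then have r: "0 < r" using L by linarith
    have "DERIV F r :> L * ((- 2 * s) * r powr (- 2 * s - 1) / (2 * s)) - (1 - 2 * s) * r powr (1 - 2 * s - 1) / (2 * s - 1)"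
      unfolding F_def by (intro DERIV_diff DERIV_cmult DERIV_cdivide has_real_derivative_powr r)
    also have "L * ((- 2 * s) * r powr (- 2 * s - 1) / (2 * s)) - (1 - 2 * s) * r powr (1 - 2 * s - 1) / (2 * s - 1)
      = r powr (- 2 * s) - L * r powr (- 2 * s - 1)"
    proof -
      have "(1 - 2 * s) / (2 * s - 1) = -1" using s by (simp add: field_simps)
      then show ?thesis using s by (simp add: field_simps)
    qed
    also have "r powr (- 2 * s) = r * r powr - (1 + 2 * s)"
      using r powr_mult_base[of r "- (1 + 2 * s)"] by simp
    also have "r * r powr - (1 + 2 * s) - L * r powr (- 2 * s - 1) = (r - L) * r powr - (1 + 2 * s)"
    proof -
      have "- 2 * s - 1 = - (1 + 2 * s)" by simp
      then show ?thesis by (simp only: left_diff_distrib)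
    qed
    finally show "DERIV F r :> (r - L) * r powr - (1 + 2 * s)" .
    show "0 \<le> (r - L) * r powr - (1 + 2 * s)" using \<open>L \<le> r\<close> by simp
  next
    have "((\<lambda>r. r powr e) \<longlongrightarrow> 0) at_top" if "e < 0" for e :: real
      using tendsto_neg_powr[OF that filterlim_ident] .
    note lim = this
    have "((\<lambda>r. L * (r powr (- 2 * s) / (2 * s)) - r powr (1 - 2 * s) / (2 * s - 1)) \<longlongrightarrow> L * (0 / (2 * s)) - 0 / (2 * s - 1)) at_top"
      by (intro tendsto_diff tendsto_mult tendsto_divide tendsto_const lim) (use s in auto)
    then show "(F \<longlongrightarrow> 0) at_top" by (simp add: F_def[abs_def])
  qed measurable
  also have "0 - F L = L powr (1 - 2 * s) * (1 / (2 * s - 1) - 1 / (2 * s))"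
    using L powr_mult_base[of L "- 2 * s"] by (simp add: F_def algebra_simps)
  finally show ?thesis .
qed

text \<open>Chebyshev's inequality bounds the measure of the intermediate region between the levels
  -(1 - \<eta>) and 1 - \<eta> by L = M / \<omega>. By \<open>crossing_measure\<close>, for r > L
  the increment over r is at least 2(1 - \<eta>) on a set of measure at least r - L. Integrating
  against the kernel over r \<ge> L gives the bound.\<close>

lemma energy_lower_bound:
  assumes W: "continuous_on UNIV W" "\<And>z. 0 \<le> W z"
    and u: "u \<in> transitions s" and s: "1/2 < s" and \<eta>: "0 < \<eta>" "\<eta> < 1"
    and \<omega>: "0 < \<omega>" "\<And>z. \<bar>z\<bar> \<le> 1 - \<eta> \<Longrightarrow> \<omega> \<le> W z"
    and M: "0 < M" "energy W s u \<le> ennreal M"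
  shows "ennreal (8 * (1 - \<eta>)\<^sup>2 * ((M / \<omega>) powr (1 - 2 * s) * (1 / (2 * s - 1) - 1 / (2 * s)))) \<le> energy W s u"
proof -
  have [measurable]: "W \<in> borel_measurable borel" using W(1) by (rule borel_measurable_continuous_onI)
  have m[measurable]: "u \<in> borel_measurable borel" using transitionsD(2)[OF u] .
  define L where "L = M / \<omega>"
  have L: "0 < L" using M(1) \<omega>(1) by (simp add: L_def)
  let ?C = "{x. - (1 - \<eta>) \<le> u x \<and> u x < 1 - \<eta>}"
  have "ennreal \<omega> * emeasure lborel ?C = (\<integral>\<^sup>+x. ennreal \<omega> * indicator ?C x \<partial>lborel)"
    by (simp add: nn_integral_cmult_indicator)
  also have "\<dots> \<le> (\<integral>\<^sup>+x. ennreal (W (u x)) \<partial>lborel)"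
    using \<omega>(2) by (intro nn_integral_mono) (auto simp: indicator_def abs_le_iff intro!: ennreal_leI)
  also have "\<dots> \<le> energy W s u" unfolding energy_def by simp
  also have "\<dots> \<le> ennreal M" by (rule M(2))
  finally have C1: "ennreal \<omega> * emeasure lborel ?C \<le> ennreal M" .
  have C: "emeasure lborel ?C \<le> ennreal L"
  proof -
    have "emeasure lborel ?C = ennreal (1 / \<omega>) * (ennreal \<omega> * emeasure lborel ?C)"
      using \<omega>(1) by (simp add: mult.assoc[symmetric] ennreal_mult'[symmetric])
    also have "\<dots> \<le> ennreal (1 / \<omega>) * ennreal M" using C1 by (rule mult_left_mono) simp
    also have "\<dots> = ennreal L" using \<omega>(1) M(1) by (simp add: L_def ennreal_mult'[symmetric])
    finally show ?thesis .
  qed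
  have "\<forall>\<^sub>F x in at_top. 1 - \<eta> < u x" using transitionsD(3)[OF u] \<eta> by (intro order_tendstoD) auto
  then obtain T1 where T1: "\<And>x. T1 \<le> x \<Longrightarrow> 1 - \<eta> < u x" by (auto simp: eventually_at_top_linorder)
  have "\<forall>\<^sub>F x in at_bot. u x < - (1 - \<eta>)" using transitionsD(4)[OF u] \<eta> by (intro order_tendstoD) auto
  then obtain T2 where T2: "\<And>x. x \<le> T2 \<Longrightarrow> u x < - (1 - \<eta>)" by (auto simp: eventually_at_bot_linorder)
  define T where "T = max 0 (max T1 (- T2))"
  have D: "ennreal (4 * (1 - \<eta>)\<^sup>2) * ennreal (r - L) \<le> sqdiff u r" if r: "0 < r" for r
  proof -
    let ?M = "{x. u x < - (1 - \<eta>) \<and> 1 - \<eta> \<le> u (x + r)}"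
    have "ennreal r \<le> emeasure lborel ?M + emeasure lborel ?C"
      by (rule crossing_measure[OF m r, of _ _ T]) (use \<eta> T1 T2 in \<open>auto simp: T_def intro: less_imp_le\<close>)
    also have "\<dots> \<le> emeasure lborel ?M + ennreal L" using C by (rule add_left_mono)
    finally have "ennreal r - ennreal L \<le> emeasure lborel ?M"
      by (simp add: ennreal_minus_le_iff add.commute)
    then have "ennreal (r - L) \<le> emeasure lborel ?M" using L by (simp add: ennreal_minus)
    then have "ennreal (4 * (1 - \<eta>)\<^sup>2) * ennreal (r - L) \<le> ennreal (4 * (1 - \<eta>)\<^sup>2) * emeasure lborel ?M"
      by (rule mult_left_mono) simp
    also have "\<dots> = (\<integral>\<^sup>+x. ennreal (4 * (1 - \<eta>)\<^sup>2) * indicator ?M x \<partial>lborel)"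
      by (simp add: nn_integral_cmult_indicator)
    also have "\<dots> \<le> sqdiff u r"
      unfolding sqdiff_def
    proof (rule nn_integral_mono)
      fix x
      show "ennreal (4 * (1 - \<eta>)\<^sup>2) * indicator ?M x \<le> ennreal ((u (x + r) - u x)\<^sup>2)"
      proof (cases "x \<in> ?M")
        case True
        then have "2 * (1 - \<eta>) \<le> u (x + r) - u x" by simp
        then have "(2 * (1 - \<eta>))\<^sup>2 \<le> (u (x + r) - u x)\<^sup>2" using \<eta> by (intro power_mono) auto
        moreover have "(2 * (1 - \<eta>))\<^sup>2 = 4 * (1 - \<eta>)\<^sup>2" by (simp only: power_mult_distrib) simp
        ultimately show ?thesis using True by (simp only: indicator_simps mult_1_right ennreal_leI)
      qed simp
    qed
    finally show ?thesis .
  qed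
  have "ennreal (4 * (1 - \<eta>)\<^sup>2) * (\<integral>\<^sup>+r. ennreal ((r - L) * r powr - (1 + 2 * s)) * indicator {L..} r \<partial>lborel)
    = (\<integral>\<^sup>+r. ennreal (4 * (1 - \<eta>)\<^sup>2) * (ennreal ((r - L) * r powr - (1 + 2 * s)) * indicator {L..} r) \<partial>lborel)"
    by (rule nn_integral_cmult[symmetric]) measurable
  also have "\<dots> \<le> (\<integral>\<^sup>+r\<in>{0<..}. sqdiff u r * ennreal (r powr - (1 + 2 * s)) \<partial>lborel)"
  proof (rule nn_integral_mono)
    fix r :: real
    show "ennreal (4 * (1 - \<eta>)\<^sup>2) * (ennreal ((r - L) * r powr - (1 + 2 * s)) * indicator {L..} r)
      \<le> sqdiff u r * ennreal (r powr - (1 + 2 * s)) * indicator {0<..} r"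
    proof (cases "L \<le> r")
      case True
      then have r: "0 < r" using L by linarith
      have "ennreal (4 * (1 - \<eta>)\<^sup>2) * ennreal (r - L) * ennreal (r powr - (1 + 2 * s)) \<le> sqdiff u r * ennreal (r powr - (1 + 2 * s))"
        using D[OF r] by (rule mult_right_mono) simp
      then show ?thesis using True r by (simp add: ennreal_mult mult.assoc)
    qed simp
  qed
  finally have I: "ennreal (4 * (1 - \<eta>)\<^sup>2) * (\<integral>\<^sup>+r. ennreal ((r - L) * r powr - (1 + 2 * s)) * indicator {L..} r \<partial>lborel)
    \<le> (\<integral>\<^sup>+r\<in>{0<..}. sqdiff u r * ennreal (r powr - (1 + 2 * s)) \<partial>lborel)" .
  have "ennreal (8 * (1 - \<eta>)\<^sup>2 * (L powr (1 - 2 * s) * (1 / (2 * s - 1) - 1 / (2 * s))))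
    = 2 * (ennreal (4 * (1 - \<eta>)\<^sup>2) * (\<integral>\<^sup>+r. ennreal ((r - L) * r powr - (1 + 2 * s)) * indicator {L..} r \<partial>lborel))"
    unfolding nn_integral_tail_kernel[OF s L]
    by (simp add: ennreal_mult'[symmetric] mult.assoc del: ennreal_numeral flip: ennreal_numeral)
  also have "\<dots> \<le> 2 * (\<integral>\<^sup>+r\<in>{0<..}. sqdiff u r * ennreal (r powr - (1 + 2 * s)) \<partial>lborel)"
    using I by (rule mult_left_mono) simp
  also have "\<dots> = gagliardo s UNIV u" by (rule gagliardo_eq[OF m, symmetric])
  also have "\<dots> \<le> energy W s u" unfolding energy_def by simp
  finally show ?thesis unfolding L_def .
qed

text \<open>A competitor either has energy above 8 / (2s - 1), or this number serves as M in
  \<open>energy_lower_bound\<close>. Hence the minimum of two terms, here multiplied by 2s -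
  1.\<close>

lemma min_energy_lower_bound:
  assumes W: "continuous_on UNIV W" "\<And>z. 0 \<le> W z" "W 1 = 0" "W (-1) = 0"
    and s: "s \<in> {1/2<..<1}" and \<eta>: "0 < \<eta>" "\<eta> < 1"
    and \<omega>: "0 < \<omega>" "\<And>z. \<bar>z\<bar> \<le> 1 - \<eta> \<Longrightarrow> \<omega> \<le> W z"
  shows "min 8 (8 * (1 - \<eta>)\<^sup>2 * ((8 / (2 * s - 1) / \<omega>) powr (1 - 2 * s) * (1 - (2 * s - 1) / (2 * s))))
    \<le> (2 * s - 1) * enn2real (min_energy W s)"
proof -
  define A where "A = 8 * (1 - \<eta>)\<^sup>2 * ((8 / (2 * s - 1) / \<omega>) powr (1 - 2 * s) * (1 / (2 * s - 1) - 1 / (2 * s)))"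
  have "ennreal (min (8 / (2 * s - 1)) A) \<le> energy W s u" if u: "u \<in> transitions s" for u
  proof (cases "energy W s u \<le> ennreal (8 / (2 * s - 1))")
    case True
    have "ennreal A \<le> energy W s u"
      unfolding A_def by (rule energy_lower_bound[OF W(1,2) u _ \<eta> \<omega> _ True]) (use s in auto)
    then show ?thesis by (rule order_trans[rotated]) (simp add: ennreal_leI)
  next
    case False
    then show ?thesis by (intro order_trans[OF ennreal_leI less_imp_le]) (auto simp: not_le)
  qed
  then have "ennreal (min (8 / (2 * s - 1)) A) \<le> min_energy W s"
    unfolding min_energy_def by (intro INF_greatest)
  then have "min (8 / (2 * s - 1)) A \<le> enn2real (min_energy W s)"
    using min_energy_finite[OF W(1,3,4) s] by (cases "min_energy W s") (auto simp: ennreal_le_iff2)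
  then have "(2 * s - 1) * min (8 / (2 * s - 1)) A \<le> (2 * s - 1) * enn2real (min_energy W s)"
    using s by (intro mult_left_mono) auto
  moreover have "(2 * s - 1) * min (8 / (2 * s - 1)) A = min 8 ((2 * s - 1) * A)"
  proof -
    have "(2 * s - 1) * (8 / (2 * s - 1)) = 8"
      unfolding times_divide_eq_right by (rule nonzero_mult_div_cancel_left) (use s in auto)
    then show ?thesis using s by (simp only: min_mult_distrib_left) simp
  qed
  moreover have "(2 * s - 1) * A = 8 * (1 - \<eta>)\<^sup>2 * ((8 / (2 * s - 1) / \<omega>) powr (1 - 2 * s) * (1 - (2 * s - 1) / (2 * s)))"
  proof -
    have "(2 * s - 1) * (1 / (2 * s - 1) - 1 / (2 * s)) = 1 - (2 * s - 1) / (2 * s)"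
      using s by (simp add: right_diff_distrib)
    moreover have "(2 * s - 1) * A = 8 * (1 - \<eta>)\<^sup>2 * ((8 / (2 * s - 1) / \<omega>) powr (1 - 2 * s) * ((2 * s - 1) * (1 / (2 * s - 1) - 1 / (2 * s))))"
      unfolding A_def by (simp only: mult_ac)
    ultimately show ?thesis by (simp only:)
  qed
  ultimately show ?thesis by simp
qed

text \<open>The ramp \<open>clamp1\<close> is the test profile. After multiplication by 2s - 1, its
  singular term 8 / (2s - 1) becomes the constant 8 and the rest keeps a factor vanishing at s =
  1/2.\<close>

lemma min_energy_upper_bound:
  assumes W: "continuous_on UNIV W" "W 1 = 0" "W (-1) = 0" and s: "s \<in> {1/2<..<1}"
  shows "(2 * s - 1) * enn2real (min_energy W s)
    \<le> (2 * s - 1) * (enn2real (\<integral>\<^sup>+x. ennreal (W (clamp1 x)) \<partial>lborel) + 6 / (2 - 2 * s) + 8 / s) + 8"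
proof -
  have "\<bar>clamp1 x - clamp1 y\<bar> \<le> 1 * \<bar>x - y\<bar>" for x y using clamp1_lipschitz[of x y] by simp
  note E = energy_lipschitz_plateau(1,2)[OF W plateau_clamp1 this s]
  have s': "1/2 < s" "s < 1" using s by auto
  note G = gagliardo_clamp1[OF s']
  have "enn2real (min_energy W s) \<le> enn2real (energy W s clamp1)"
    using E by (intro enn2real_mono) auto
  also have "\<dots> = enn2real (\<integral>\<^sup>+x. ennreal (W (clamp1 x)) \<partial>lborel) + enn2real (gagliardo s UNIV clamp1)"
    using E(1) by (simp add: energy_def enn2real_plus)
  also have "enn2real (gagliardo s UNIV clamp1) \<le> 6 / (2 - 2 * s) + 8 / (2 * s - 1) + 8 / s"
    using s' by (intro enn2real_leI G) auto
  finally have "(2 * s - 1) * enn2real (min_energy W s) \<le>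
    (2 * s - 1) * (enn2real (\<integral>\<^sup>+x. ennreal (W (clamp1 x)) \<partial>lborel) + (6 / (2 - 2 * s) + 8 / (2 * s - 1) + 8 / s))"
    using s' by (intro mult_left_mono) auto
  also have "\<dots> = (2 * s - 1) * (enn2real (\<integral>\<^sup>+x. ennreal (W (clamp1 x)) \<partial>lborel) + 6 / (2 - 2 * s) + 8 / s) + 8"
    using s' by (simp add: distrib_left) (simp add: field_simps)
  finally show ?thesis .
qed

lemma scaled_min_energy_tendsto:
  assumes W: "continuous_on UNIV W" "\<And>z. 0 \<le> W z" "\<And>z. W z = 0 \<longleftrightarrow> z = 1 \<or> z = -1"
  shows "((\<lambda>s. (2 * s - 1) * enn2real (min_energy W s)) \<longlongrightarrow> 8) (at_right (1/2))"
proof -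
  have W01: "W 1 = 0" "W (-1) = 0" using W(3) by auto
  have ev: "\<forall>\<^sub>F s in at_right (1/2::real). s \<in> {1/2<..<1}" by (rule eventually_at_right_real) simp
  show ?thesis
  proof (rule order_tendstoI)
    fix c :: real assume c: "c < 8"
    \<comment> \<open>First \<eta> is fixed with 8(1 - \<eta>)^2 still above c; only then does s
      tend to 1/2.\<close>
    have "((\<lambda>\<eta>::real. 8 * (1 - \<eta>)\<^sup>2) \<longlongrightarrow> 8 * (1 - 0)\<^sup>2) (at_right 0)" by (intro tendsto_intros)
    then have "\<forall>\<^sub>F \<eta> in at_right (0::real). c < 8 * (1 - \<eta>)\<^sup>2" using c by (intro order_tendstoD) auto
    moreover have "\<forall>\<^sub>F \<eta> in at_right (0::real). \<eta> \<in> {0<..<1}" by (rule eventually_at_right_real) simp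
    ultimately have "\<forall>\<^sub>F \<eta> in at_right (0::real). c < 8 * (1 - \<eta>)\<^sup>2 \<and> \<eta> \<in> {0<..<1}" by (rule eventually_conj)
    then obtain \<eta> :: real where \<eta>: "0 < \<eta>" "\<eta> < 1" "c < 8 * (1 - \<eta>)\<^sup>2"
      using eventually_happens'[of "at_right (0::real)"] trivial_limit_at_right_real by auto
    \<comment> \<open>The compact interval contains neither well, so the minimum of W on it is
      positive and serves as \<omega>.\<close>
    have "\<exists>x\<in>{- (1 - \<eta>)..1 - \<eta>}. \<forall>y\<in>{- (1 - \<eta>)..1 - \<eta>}. W x \<le> W y"
      using \<eta> W(1) by (intro continuous_attains_inf) (auto intro: continuous_on_subset)
    then obtain x where x: "x \<in> {- (1 - \<eta>)..1 - \<eta>}" "\<And>y. y \<in> {- (1 - \<eta>)..1 - \<eta>} \<Longrightarrow> W x \<le> W y" by blast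
    have "W x \<noteq> 0" using W(3)[of x] x(1) \<eta> by auto
    then have \<omega>: "0 < W x" using W(2)[of x] by linarith
    have \<omega>': "W x \<le> W z" if "\<bar>z\<bar> \<le> 1 - \<eta>" for z using that by (intro x(2)) (auto simp: abs_le_iff)
    define \<omega> where "\<omega> = W x"
    \<comment> \<open>With d = 2s - 1 the power is (8 / (d \<omega>))^(-d), which tends to 1 because
      d ln d tends to 0.\<close>
    have "((\<lambda>s::real. (8 / (2 * s - 1) / \<omega>) powr (1 - 2 * s) * (1 - (2 * s - 1) / (2 * s))) \<longlongrightarrow> 1) (at_right (1/2))"
      using \<omega> unfolding \<omega>_def[symmetric] by real_asymp
    then have "((\<lambda>s::real. min 8 (8 * (1 - \<eta>)\<^sup>2 * ((8 / (2 * s - 1) / \<omega>) powr (1 - 2 * s) * (1 - (2 * s - 1) / (2 * s)))))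
      \<longlongrightarrow> min 8 (8 * (1 - \<eta>)\<^sup>2 * 1)) (at_right (1/2))"
      by (intro tendsto_min tendsto_mult tendsto_const)
    then have "\<forall>\<^sub>F s in at_right (1/2). c < min 8 (8 * (1 - \<eta>)\<^sup>2 * ((8 / (2 * s - 1) / \<omega>) powr (1 - 2 * s) * (1 - (2 * s - 1) / (2 * s))))"
      by (rule order_tendstoD) (use c \<eta>(3) in auto)
    with ev show "\<forall>\<^sub>F s in at_right (1/2). c < (2 * s - 1) * enn2real (min_energy W s)"
    proof eventually_elim
      case (elim s)
      show ?case
        using elim(2) min_energy_lower_bound[OF W(1,2) W01 elim(1) \<eta>(1,2) \<omega> \<omega>'] unfolding \<omega>_def by (rule less_le_trans)
    qed
  next
    fix c :: real assume c: "8 < c"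
    define P where "P = enn2real (\<integral>\<^sup>+x. ennreal (W (clamp1 x)) \<partial>lborel)"
    have "((\<lambda>s::real. (2 * s - 1) * (P + 6 / (2 - 2 * s) + 8 / s) + 8) \<longlongrightarrow> 8) (at_right (1/2))"
      by real_asymp
    then have "\<forall>\<^sub>F s in at_right (1/2). (2 * s - 1) * (P + 6 / (2 - 2 * s) + 8 / s) + 8 < c"
      using c by (rule order_tendstoD)
    with ev show "\<forall>\<^sub>F s in at_right (1/2). (2 * s - 1) * enn2real (min_energy W s) < c"
    proof eventually_elim
      case (elim s)
      show ?case
        using min_energy_upper_bound[OF W(1) W01 elim(1)] elim(2) unfolding P_def by (rule le_less_trans)
    qed
  qed
qed

section \<open>Continuity of the surface tension, including the endpoint 1/2\<close>

theorem mainTheorem4: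
  fixes W :: "real \<Rightarrow> real"
  assumes "double_well W"
  shows "(\<forall>s\<in>{1/2<..<1}. min_energy W s < \<infinity>) \<and>
         continuous_on {1/2..<1} (surface_tension W)"
proof -
  have W: "continuous_on UNIV W" "\<And>z. 0 \<le> W z" "\<And>z. W z = 0 \<longleftrightarrow> z = 1 \<or> z = -1"
    using assms by (auto simp: double_well_def)
  have W01: "W 1 = 0" "W (-1) = 0" using W(3) by auto
  have fin: "min_energy W s < \<infinity>" if "s \<in> {1/2<..<1}" for s
    using min_energy_finite[OF W(1) W01 that] .
  have "continuous (at s within {1/2..<1}) (surface_tension W)" if s: "s \<in> {1/2..<1}" for s
  proof (cases "s = 1/2")
    case True
    have "\<forall>\<^sub>F s in at_right (1/2). (2 * s - 1) * enn2real (min_energy W s) = surface_tension W s"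
      using eventually_at_right_less[of "1/2::real"] by eventually_elim (simp add: surface_tension_def)
    then have "(surface_tension W \<longlongrightarrow> 8) (at_right (1/2))"
      using scaled_min_energy_tendsto[OF W] by (rule Lim_transform_eventually[rotated])
    \<comment> \<open>Removing the endpoint leaves only points to its right, so the right-hand limit
      is all that is required.\<close>
    moreover have "at (1/2) within {1/2..<1} = at (1/2) within ({1/2..<1} - {1/2::real})"
      by (simp add: at_within_def)
    then have "at (1/2) within {1/2..<1} \<le> at_right (1/2::real)"
      by (simp only:) (rule at_le, auto)
    ultimately have "(surface_tension W \<longlongrightarrow> 8) (at (1/2) within {1/2..<1})"
      by (rule tendsto_mono[rotated])
    then show ?thesis
      unfolding True continuous_within by (simp add: surface_tension_def)
  next
    case False
    then have s': "s \<in> {1/2<..<1}" using s by auto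
    have "((\<lambda>\<sigma>. enn2real (min_energy W \<sigma>)) \<longlongrightarrow> enn2real (min_energy W s)) (nhds s)"
      by (rule order_tendstoI) (use min_energy_lsc[OF W s'] min_energy_usc[OF W(1,2) W01 s'] in auto)
    then have "((\<lambda>\<sigma>. enn2real (min_energy W \<sigma>)) \<longlongrightarrow> enn2real (min_energy W s)) (at s)"
      by (rule tendsto_mono[OF at_within_le_nhds])
    then have "((\<lambda>\<sigma>. (2 * \<sigma> - 1) * enn2real (min_energy W \<sigma>)) \<longlongrightarrow> (2 * s - 1) * enn2real (min_energy W s)) (at s)"
      by (intro tendsto_mult tendsto_diff tendsto_const tendsto_ident_at)
    moreover have "\<forall>\<^sub>F \<sigma> in at s. \<sigma> \<in> {1/2<..<1}" by (rule eventually_at_in_open'[OF _ s']) simp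
    then have "\<forall>\<^sub>F \<sigma> in at s. (2 * \<sigma> - 1) * enn2real (min_energy W \<sigma>) = surface_tension W \<sigma>"
      by eventually_elim (auto simp: surface_tension_def)
    ultimately have "(surface_tension W \<longlongrightarrow> (2 * s - 1) * enn2real (min_energy W s)) (at s)"
      by (rule Lim_transform_eventually)
    then have "isCont (surface_tension W) s" using False by (simp add: isCont_def surface_tension_def)
    then show ?thesis by (rule continuous_at_imp_continuous_at_within)
  qed
  then show ?thesis using fin by (simp add: continuous_on_eq_continuous_within)
qed

end
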